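(* Let $G=(V,E)$ be a loopless graph (multiple edges allowed), viewed as a hypergraph in which every hyperedge has two elements, and fix a ribbon structure, base node and base edge on $\mathrm{Bip}\,G$. Let $T$ be a $V$-cut Jaeger tree of $\mathrm{Bip}\,G$. Then the number of internally inactive elements of $E$ for the hypertree $\mathbf f_E(T)$, with respect to the violet $T$-order on $E$, equals the number of internally inactive elements of $V$ for the hypertree $\mathbf f_V(T)$, with respect to the violet $T$-order on $V$.
   Context: $\mathrm{Bip}\,G$ is the bipartite graph with color classes $V$ (violet) and $E$ (emerald), each $e\in E$ joined to its two endpoints (i.e., $G$ with each edge subdivided). A ribbon structure assigns to each node $x$ a cyclic permutation of its incident edges; $xy^+$ is the edge following $xy$ at $x$. Base node $b_0$, incident base edge $b_0b_1$. Tour of a spanning tree $T$ of $\mathrm{Bip}\,G$: pairs (current node, current edge) starting with $(b_0,b_0b_1)$; from $(x,xy)$ go to $(x,xy^+)$ if $xy\notin T$, to $(y,yx^+)$ if $xy\in T$; stop right before $(b_0,b_0b_1)$ recurs. Each edge $xy$ appears exactly twice; a non-edge $xy$ is cut at $x$ if $(x,xy)$ comes first. $T$ is a $V$-cut Jaeger tree if every non-edge of $T$ is cut at its violet endpoint. Violet $T$-order on edges: $ev<_{T,V}e'v'$ ($v,v'\in V$) iff $(v,ev)$ precedes $(v',e'v')$ in the tour. Violet $T$-order on $E$ (resp. $V$): $x_1<x_2$ iff some edge incident to $x_1$ precedes in the violet $T$-order every edge incident to $x_2$. A hypertree on $E$ is $\mathbf f:E\to\mathbb Z_{\ge0}$ such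 that some spanning tree of $\mathrm{Bip}\,G$ has degree $\mathbf f(e)+1$ at each $e\in E$; similarly on $V$; $\mathbf f_E(T)(e)=d_T(e)-1$, $\mathbf f_V(T)(v)=d_T(v)-1$. Given a linear order on $X\in\{E,V\}$ and a hypertree $\mathbf f$ on $X$, $x\in X$ is internally inactive if there is $x'<x$ such that decreasing $\mathbf f$ by $1$ at $x$ and increasing by $1$ at $x'$ yields a hypertree on $X$. *)

theory Defs
  imports "HOL-Combinatorics.Combinatorics"
begin

record ('v, 'e) mgraph =
  verts :: "'v set"
  edges :: "'e set"
  ends :: "'e \<Rightarrow> 'v set"

text \<open>Parallel edges are distinct members of \<^term>\<open>edges G\<close> with the same set of end points.\<close>

definition loopless_graph :: "('v, 'e) mgraph \<Rightarrow> bool" where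
  "loopless_graph G \<longleftrightarrow> finite (verts G) \<and> finite (edges G) \<and>
     (\<forall>e\<in>edges G. ends G e \<subseteq> verts G \<and> card (ends G e) = 2)"

text \<open>
  Since \<open>G\<close> is loopless, \<open>Bip G\<close> is a simple bipartite graph; the pair \<open>(v, e)\<close> encodes its
  edge joining the violet node \<open>v\<close> to the emerald node \<open>e\<close>.
\<close>

datatype ('v, 'e) node = Violet 'v | Emerald 'e

type_synonym ('v, 'e) bedge = "'v \<times> 'e"

definition violet :: "('v, 'e) mgraph \<Rightarrow> ('v, 'e) node set" where
  "violet G = Violet ` verts G"

definition emerald :: "('v, 'e) mgraph \<Rightarrow> ('v, 'e) node set" where
  "emerald G = Emerald ` edges G"

definition bip_nodes :: "('v, 'e) mgraph \<Rightarrow> ('v, 'e) node set" where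
  "bip_nodes G = violet G \<union> emerald G"

definition bip_edges :: "('v, 'e) mgraph \<Rightarrow> ('v, 'e) bedge set" where
  "bip_edges G = {(v, e). e \<in> edges G \<and> v \<in> ends G e}"

definition violet_end :: "('v, 'e) bedge \<Rightarrow> ('v, 'e) node" where
  "violet_end a = Violet (fst a)"

definition emerald_end :: "('v, 'e) bedge \<Rightarrow> ('v, 'e) node" where
  "emerald_end a = Emerald (snd a)"

definition endpoints :: "('v, 'e) bedge \<Rightarrow> ('v, 'e) node set" where
  "endpoints a = {violet_end a, emerald_end a}"

definition opposite :: "('v, 'e) node \<Rightarrow> ('v, 'e) bedge \<Rightarrow> ('v, 'e) node" where
  "opposite x a = (if x = violet_end a then emerald_end a else violet_end a)"

definition incident :: "('v, 'e) bedge set \<Rightarrow> ('v, 'e) node \<Rightarrow> ('v, 'e) bedge set" where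
  "incident S x = {a \<in> S. x \<in> endpoints a}"

definition adjacent :: "('v, 'e) bedge set \<Rightarrow> ('v, 'e) node \<Rightarrow> ('v, 'e) node \<Rightarrow> bool" where
  "adjacent S x y \<longleftrightarrow> (\<exists>a\<in>S. endpoints a = {x, y})"

definition is_cycle :: "('v, 'e) bedge set \<Rightarrow> ('v, 'e) node list \<Rightarrow> bool" where
  "is_cycle S xs \<longleftrightarrow> length xs \<ge> 3 \<and> distinct xs \<and>
     (\<forall>i<length xs. adjacent S (xs ! i) (xs ! (Suc i mod length xs)))"

definition spanning_tree :: "('v, 'e) mgraph \<Rightarrow> ('v, 'e) bedge set \<Rightarrow> bool" where
  "spanning_tree G T \<longleftrightarrow> T \<subseteq> bip_edges G \<and>
     (\<forall>x\<in>bip_nodes G. \<forall>y\<in>bip_nodes G. (adjacent T)\<^sup>*\<^sup>* x y) \<and>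
     (\<nexists>xs. is_cycle T xs)"

text \<open>
  \<open>rib x a\<close> is the edge that follows \<open>a\<close> at the node \<open>x\<close>. An isolated node has no incident
  edges to permute, and \<^const>\<open>cyclic_on\<close> is false on the empty set.
\<close>

definition ribbon_structure ::
  "('v, 'e) mgraph \<Rightarrow> (('v, 'e) node \<Rightarrow> ('v, 'e) bedge \<Rightarrow> ('v, 'e) bedge) \<Rightarrow> bool" where
  "ribbon_structure G rib \<longleftrightarrow>
     (\<forall>x\<in>bip_nodes G. incident (bip_edges G) x \<noteq> {} \<longrightarrow>
        cyclic_on (rib x) (incident (bip_edges G) x))"

context
  fixes G :: "('v, 'e) mgraph"
    and rib :: "('v, 'e) node \<Rightarrow> ('v, 'e) bedge \<Rightarrow> ('v, 'e) bedge"
    and b0 :: "('v, 'e) node" and base :: "('v, 'e) bedge"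
    and T :: "('v, 'e) bedge set"
begin

definition tour_step :: "('v, 'e) node \<times> ('v, 'e) bedge \<Rightarrow> ('v, 'e) node \<times> ('v, 'e) bedge" where
  "tour_step = (\<lambda>(x, a). let y = (if a \<in> T then opposite x a else x) in (y, rib y a))"

definition tour_length :: nat where
  "tour_length = (LEAST n. n > 0 \<and> (tour_step ^^ n) (b0, base) = (b0, base))"

definition tour :: "(('v, 'e) node \<times> ('v, 'e) bedge) list" where
  "tour = map (\<lambda>i. (tour_step ^^ i) (b0, base)) [0..<tour_length]"

definition precedes ::
  "('v, 'e) node \<times> ('v, 'e) bedge \<Rightarrow> ('v, 'e) node \<times> ('v, 'e) bedge \<Rightarrow> bool" where
  "precedes p q \<longleftrightarrow> (\<exists>i j. i < j \<and> j < length tour \<and> tour ! i = p \<and> tour ! j = q)"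

definition cut_at :: "('v, 'e) node \<Rightarrow> ('v, 'e) bedge \<Rightarrow> bool" where
  "cut_at x a \<longleftrightarrow> x \<in> endpoints a \<and> a \<notin> T \<and> precedes (x, a) (opposite x a, a)"

definition V_cut_Jaeger_tree :: bool where
  "V_cut_Jaeger_tree \<longleftrightarrow> spanning_tree G T \<and> (\<forall>a \<in> bip_edges G - T. cut_at (violet_end a) a)"

definition violet_edge_less :: "('v, 'e) bedge \<Rightarrow> ('v, 'e) bedge \<Rightarrow> bool" where
  "violet_edge_less a a' \<longleftrightarrow> precedes (violet_end a, a) (violet_end a', a')"

text \<open>Used on each of the two color classes separately.\<close>

definition violet_less :: "('v, 'e) node \<Rightarrow> ('v, 'e) node \<Rightarrow> bool" where
  "violet_less x1 x2 \<longleftrightarrow> (\<exists>a \<in> incident (bip_edges G) x1.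
     \<forall>a' \<in> incident (bip_edges G) x2. violet_edge_less a a')"

end

text \<open>
  In the following definitions \<open>X\<close> is one of the two color classes, and a function on \<open>X\<close> is an
  integer-valued function on all nodes whose values outside \<open>X\<close> are irrelevant.
\<close>

definition hypertree ::
  "('v, 'e) mgraph \<Rightarrow> ('v, 'e) node set \<Rightarrow> (('v, 'e) node \<Rightarrow> int) \<Rightarrow> bool" where
  "hypertree G X f \<longleftrightarrow> (\<forall>x\<in>X. f x \<ge> 0) \<and>
     (\<exists>T. spanning_tree G T \<and> (\<forall>x\<in>X. int (card (incident T x)) = f x + 1))"

definition tree_hypertree :: "('v, 'e) bedge set \<Rightarrow> ('v, 'e) node \<Rightarrow> int" where
  "tree_hypertree T x = int (card (incident T x)) - 1"

definition internally_inactive ::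
  "('v, 'e) mgraph \<Rightarrow> ('v, 'e) node set \<Rightarrow> (('v, 'e) node \<Rightarrow> ('v, 'e) node \<Rightarrow> bool) \<Rightarrow>
   (('v, 'e) node \<Rightarrow> int) \<Rightarrow> ('v, 'e) node \<Rightarrow> bool" where
  "internally_inactive G X lt f x \<longleftrightarrow>
     (\<exists>x'\<in>X. lt x' x \<and> hypertree G X (f(x := f x - 1, x' := f x' + 1)))"

end

theory Submission
  imports Defs
begin

text \<open>
  Let \<open>r\<close> be the first violet node of the tour. Every other violet node \<open>v\<close> is joined by a unique tree
  edge to its parent \<open>e\<close> towards \<open>r\<close>, and \<open>v \<mapsto> e\<close> is a bijection onto the emerald nodes of degree \<open>2\<close>
  in \<open>T\<close>. Let \<open>D\<close> be the component of \<open>v\<close> in \<open>T - ve\<close>. Both \<open>v\<close> and \<open>e\<close> turn out to be internally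
  inactive exactly when some edge \<open>wg\<close> of \<open>Bip G\<close> has its emerald end \<open>g\<close> in \<open>D\<close> and its violet end
  \<open>w\<close> outside. Given such an edge, \<open>T - ve + wg\<close> realizes both hypertree exchanges at once. The tour
  spends one interval of time in \<open>D\<close>, entering it through \<open>e\<close>; since \<open>wg\<close> is cut at \<open>w\<close>, it is met
  before that interval, so \<open>w < v\<close> and \<open>g < e\<close>. Without such an edge, a transfer from \<open>v\<close> to
  \<open>v'\<close> outside \<open>D\<close> leaves fewer than \<open>|D|\<close> tree edges touching \<open>D\<close>, and for a transfer from \<open>e\<close> to
  \<open>e'\<close> outside \<open>D\<close> either \<open>e'\<close> does not reconnect \<open>D\<close> to the rest or the cut condition forces
  \<open>e < e'\<close>.
\<close>

subsection \<open>Bridges and exchanges in forests\<close>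

lemma endpoints_pair [simp]: "endpoints (v, e) = {Violet v, Emerald e}"
  by (simp add: endpoints_def violet_end_def emerald_end_def)

lemma violet_end_pair [simp]: "violet_end (v, e) = Violet v"
  by (simp add: violet_end_def)

lemma adjacent_iff:
  "adjacent S x y \<longleftrightarrow> (\<exists>v e. (v, e) \<in> S \<and>
     (x = Violet v \<and> y = Emerald e \<or> x = Emerald e \<and> y = Violet v))"
  by (force simp: adjacent_def doubleton_eq_iff)

lemma adjacent_sym: "adjacent S x y \<Longrightarrow> adjacent S y x"
  by (auto simp: adjacent_def insert_commute)

lemma adjacent_mono: "adjacent S x y \<Longrightarrow> S \<subseteq> S' \<Longrightarrow> adjacent S' x y"
  by (auto simp: adjacent_def)

lemma reach_sym: "(adjacent S)\<^sup>*\<^sup>* x y \<Longrightarrow> (adjacent S)\<^sup>*\<^sup>* y x"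
  by (induction rule: rtranclp_induct) (auto intro: adjacent_sym converse_rtranclp_into_rtranclp)

lemma reach_mono: "(adjacent S)\<^sup>*\<^sup>* x y \<Longrightarrow> S \<subseteq> S' \<Longrightarrow> (adjacent S')\<^sup>*\<^sup>* x y"
  by (induction rule: rtranclp_induct) (auto intro: adjacent_mono rtranclp.rtrancl_into_rtrancl)

lemma opposite_endpoints: "x \<in> endpoints a \<Longrightarrow> endpoints a = {x, opposite x a} \<and> opposite x a \<noteq> x"
  by (auto simp: opposite_def endpoints_def violet_end_def emerald_end_def)

lemma opposite_eqI: "endpoints a = {x, y} \<Longrightarrow> opposite x a = y"
  by (auto simp: opposite_def endpoints_def violet_end_def emerald_end_def doubleton_eq_iff)

text \<open>A union of components of \<open>S\<close>, encoded by a closure condition. It replaces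
  path arguments: a set closed under a spanning tree and containing one node contains them
  all.\<close>

definition edge_closed :: "('v, 'e) bedge set \<Rightarrow> ('v, 'e) node set \<Rightarrow> bool" where
  "edge_closed S D \<longleftrightarrow> (\<forall>a\<in>S. endpoints a \<inter> D \<noteq> {} \<longrightarrow> endpoints a \<subseteq> D)"

lemma edge_closedI:
  assumes "\<And>v e. (v, e) \<in> S \<Longrightarrow> Violet v \<in> D \<longleftrightarrow> Emerald e \<in> D"
  shows "edge_closed S D"
  using assms by (auto simp: edge_closed_def)

lemma edge_closedD: "edge_closed S D \<Longrightarrow> (v, e) \<in> S \<Longrightarrow> Violet v \<in> D \<longleftrightarrow> Emerald e \<in> D"
  by (force simp: edge_closed_def)

lemma reach_edge_closed:
  assumes "(adjacent S)\<^sup>*\<^sup>* x y" "edge_closed S D" "x \<in> D"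
  shows "y \<in> D"
  using assms(1,3) by (induction rule: rtranclp_induct) (use assms(2) in \<open>auto simp: adjacent_iff dest: edge_closedD\<close>)

text \<open>For an edge \<open>a\<close> of a tree with ends \<open>x\<close> and \<open>y\<close>,
  \<open>side T a x\<close> and \<open>side T a y\<close> are the two pieces left by deleting
  \<open>a\<close>; \<open>side T (v, e) (Violet v)\<close> is \<open>D\<close>.\<close>

definition side :: "('v, 'e) bedge set \<Rightarrow> ('v, 'e) bedge \<Rightarrow> ('v, 'e) node \<Rightarrow> ('v, 'e) node set" where
  "side S a x = {z. (adjacent (S - {a}))\<^sup>*\<^sup>* x z}"

lemma side_self [simp]: "x \<in> side S a x"
  by (simp add: side_def)

lemma side_edge_closed: "edge_closed (S - {a}) (side S a x)"
proof (rule edge_closedI)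
  fix v e assume "(v, e) \<in> S - {a}"
  then have "adjacent (S - {a}) (Violet v) (Emerald e)" "adjacent (S - {a}) (Emerald e) (Violet v)"
    by (auto simp: adjacent_iff)
  then show "Violet v \<in> side S a x \<longleftrightarrow> Emerald e \<in> side S a x"
    unfolding side_def by (auto intro: rtranclp.rtrancl_into_rtrancl)
qed

text \<open>A shortest walk that avoids \<open>(v, e)\<close> repeats no node, and the edge
  \<open>(v, e)\<close> itself closes it up to a cycle.\<close>

lemma path_gives_cycle:
  assumes path: "(adjacent (S - {(v, e)}))\<^sup>*\<^sup>* (Violet v) (Emerald e)" and "(v, e) \<in> S"
  shows "\<exists>xs. is_cycle S xs"
proof -
  let ?R = "adjacent (S - {(v, e)})"
  define n where "n = (LEAST n. (?R ^^ n) (Violet v) (Emerald e))"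
  have ex: "\<exists>n. (?R ^^ n) (Violet v) (Emerald e)"
    using path by (simp add: rtranclp_power)
  have n: "(?R ^^ n) (Violet v) (Emerald e)"
    unfolding n_def using ex by (rule LeastI_ex)
  then obtain f where f: "f 0 = Violet v" "f n = Emerald e" "\<And>i. i < n \<Longrightarrow> ?R (f i) (f (Suc i))"
    by (auto simp: relpowp_fun_conv)
  have reach: "(?R ^^ (j - i)) (f i) (f j)" if "i \<le> j" "j \<le> n" for i j
    unfolding relpowp_fun_conv using that f(3) by (intro exI[of _ "\<lambda>k. f (i + k)"]) auto
  have inj: "f i \<noteq> f j" if "i < j" "j \<le> n" for i j
  proof
    assume eq: "f i = f j"
    have "(?R ^^ (i - 0)) (f 0) (f i)" "(?R ^^ (n - j)) (f j) (f n)"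
      by (rule reach; use that in simp)+
    then have "(?R ^^ (i + (n - j))) (Violet v) (Emerald e)"
      using f(1,2) eq by (auto simp: relpowp_add)
    then have "n \<le> i + (n - j)"
      unfolding n_def by (rule Least_le)
    then show False using that by simp
  qed
  have "n \<noteq> 0" using f(1,2) by (metis node.distinct(1))
  moreover have "n \<noteq> 1" using f(1,2) f(3)[of 0] by (auto simp: adjacent_iff)
  ultimately have "n \<ge> 2" by simp
  define xs where "xs = map f [0..<Suc n]"
  have "is_cycle S xs"
    unfolding is_cycle_def
  proof (intro conjI allI impI)
    show "3 \<le> length xs" using \<open>n \<ge> 2\<close> by (simp add: xs_def)
    have "inj_on f {0..<Suc n}"
      using inj by (intro linorder_inj_onI) auto
    then show "distinct xs" unfolding xs_def by (simp only: distinct_map distinct_upt set_upt simp_thms)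
    fix i assume "i < length xs"
    then have "i \<le> n" by (simp add: xs_def)
    show "adjacent S (xs ! i) (xs ! (Suc i mod length xs))"
    proof (cases "i = n")
      case True
      then have "xs ! i = f n" "xs ! (Suc i mod length xs) = f 0"
        unfolding xs_def by (simp_all del: upt_Suc)
      then show ?thesis using f(1,2) assms(2) by (auto simp: adjacent_iff)
    next
      case False
      then have "xs ! i = f i" "xs ! (Suc i mod length xs) = f (Suc i)"
        using \<open>i \<le> n\<close> unfolding xs_def by (simp_all del: upt_Suc)
      then show ?thesis using f(3)[of i] False \<open>i \<le> n\<close> by (auto intro: adjacent_mono)
    qed
  qed
  then show ?thesis ..
qed

text \<open>One turn around the indices carries \<open>P\<close> to all of them. Used
  contrapositively, this finds a place on a cycle where membership in a set changes.\<close>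

lemma cyclic_invariant:
  assumes "\<And>i. i < n \<Longrightarrow> P i \<Longrightarrow> P (Suc i mod n)" "k < n" "P k" "j < n"
  shows "P (j::nat)"
proof -
  have *: "P ((k + i) mod n)" for i
  proof (induction i)
    case (Suc i)
    then show ?case using assms(1)[of "(k + i) mod n"] assms(2) by (simp add: mod_Suc_eq)
  qed (use assms in simp)
  show ?thesis using *[of "j + n - k"] assms by simp
qed

text \<open>In the new edge set only \<open>b\<close> joins \<open>D\<close> to its complement. A
  cycle that leaves \<open>D\<close> has to come back, so it would traverse \<open>b\<close> in both
  directions, impossible with three or more distinct nodes. Hence the cycle stays on one side and
  avoids \<open>b\<close>.\<close>

lemma cycle_exchange:
  assumes cyc: "is_cycle (insert b (S - {a})) xs" and cl: "edge_closed (S - {a}) D"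
    and b: "endpoints b = {p, q}" "p \<in> D" "q \<notin> D"
  shows "is_cycle S xs"
proof -
  let ?n = "length xs"
  let ?S = "insert b (S - {a})"
  have n: "?n \<ge> 3" and dist: "distinct xs"
    and adj: "\<And>i. i < ?n \<Longrightarrow> adjacent ?S (xs ! i) (xs ! (Suc i mod ?n))"
    using cyc by (auto simp: is_cycle_def)
  have cross: "{xs ! i, xs ! (Suc i mod ?n)} = {p, q}"
    if "i < ?n" "(xs ! i \<in> D) \<noteq> (xs ! (Suc i mod ?n) \<in> D)" for i
    using adj[OF that(1)] cl b that(2) unfolding adjacent_def edge_closed_def by blast
  have const: "(\<forall>i<?n. xs ! i \<in> D) \<or> (\<forall>i<?n. xs ! i \<notin> D)"
  proof (rule ccontr)
    assume "\<not> ?thesis"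
    then obtain k l where kl: "k < ?n" "xs ! k \<in> D" "l < ?n" "xs ! l \<notin> D" by blast
    obtain i where i: "i < ?n" "xs ! i \<in> D" "xs ! (Suc i mod ?n) \<notin> D"
      using cyclic_invariant[of ?n "\<lambda>i. xs ! i \<in> D" k l] kl by blast
    obtain j where j: "j < ?n" "xs ! j \<notin> D" "xs ! (Suc j mod ?n) \<in> D"
      using cyclic_invariant[of ?n "\<lambda>i. xs ! i \<notin> D" l k] kl by blast
    have "xs ! i = p" "xs ! (Suc i mod ?n) = q" "xs ! j = q" "xs ! (Suc j mod ?n) = p"
      using cross[OF i(1)] cross[OF j(1)] i j b by (auto simp: doubleton_eq_iff)
    moreover have "Suc i mod ?n < ?n" "Suc j mod ?n < ?n" using n by (auto intro!: mod_less_divisor)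
    ultimately have "j = Suc i mod ?n" "i = Suc j mod ?n"
      using dist i(1) j(1) by (metis nth_eq_iff_index_eq)+
    \<comment> \<open>Two successor steps modulo the length lead back to \<open>i\<close>, which
      needs length at most 2.\<close>
    then show False using n i(1) j(1)
      by (auto simp: mod_Suc split: if_splits)
  qed
  have "adjacent S (xs ! i) (xs ! (Suc i mod ?n))" if "i < ?n" for i
  proof -
    have "Suc i mod ?n < ?n" using n by (auto intro!: mod_less_divisor)
    then have "{xs ! i, xs ! (Suc i mod ?n)} \<noteq> {p, q}"
      using const that b by (metis doubleton_eq_iff)
    then show ?thesis using adj[OF that] b by (auto simp: adjacent_def)
  qed
  then show ?thesis using n dist by (simp add: is_cycle_def)
qed

text \<open>Peel off nodes one at a time: some edge leaves \<open>D\<close> at a node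
  \<open>x\<close>, and it meets \<open>D\<close> but not \<open>D - {x}\<close>, so each removed
  node costs at least one edge.\<close>

lemma card_le_incident_edges:
  assumes "finite D" "finite S" "y \<notin> D" "\<And>x. x \<in> D \<Longrightarrow> (adjacent S)\<^sup>*\<^sup>* x y"
  shows "card D \<le> card {a \<in> S. endpoints a \<inter> D \<noteq> {}}"
  using assms(1,3,4)
proof (induction "card D" arbitrary: D)
  case (Suc n)
  have "D \<noteq> {}" using Suc(2) by auto
  then have "\<not> edge_closed S D"
    using Suc(4,5) reach_edge_closed by blast
  then obtain a where "a \<in> S" "endpoints a \<inter> D \<noteq> {}" "\<not> endpoints a \<subseteq> D"
    by (auto simp: edge_closed_def)
  then obtain x z where a: "a \<in> S" "endpoints a = {x, z}" "x \<in> D" "z \<notin> D"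
    by (auto simp: endpoints_def)
  let ?E = "\<lambda>D. {a \<in> S. endpoints a \<inter> D \<noteq> {}}"
  have "card (D - {x}) \<le> card (?E (D - {x}))"
    using Suc a by (intro Suc(1)) auto
  also have "\<dots> < card (?E D)"
    using a assms(2) by (intro psubset_card_mono) auto
  finally show ?case using a Suc(2,3) by (simp add: card_Diff_singleton)
qed simp

lemma incident_Violet: "a \<in> incident S (Violet v) \<longleftrightarrow> a \<in> S \<and> fst a = v"
  by (cases a) (auto simp: incident_def)

lemma incident_Emerald: "a \<in> incident S (Emerald e) \<longleftrightarrow> a \<in> S \<and> snd a = e"
  by (cases a) (auto simp: incident_def)

subsection \<open>Tours of Jaeger trees\<close>

locale jaeger_tree =
  fixes G :: "('v, 'e) mgraph"
    and rib :: "('v, 'e) node \<Rightarrow> ('v, 'e) bedge \<Rightarrow> ('v, 'e) bedge"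
    and b0 :: "('v, 'e) node" and base :: "('v, 'e) bedge"
    and T :: "('v, 'e) bedge set"
  assumes loopless: "loopless_graph G"
    and ribbon: "ribbon_structure G rib"
    and b0_node: "b0 \<in> bip_nodes G"
    and base_incident: "base \<in> incident (bip_edges G) b0"
    and V_cut: "V_cut_Jaeger_tree G rib b0 base T"
begin

section \<open>The two sides of a tree edge\<close>

lemma tree: "spanning_tree G T"
  using V_cut by (simp add: V_cut_Jaeger_tree_def)

lemma cut_at_violet: "a \<in> bip_edges G \<Longrightarrow> a \<notin> T \<Longrightarrow> cut_at rib b0 base T (violet_end a) a"
  using V_cut by (simp add: V_cut_Jaeger_tree_def)

lemma T_subset: "T \<subseteq> bip_edges G"
  using tree by (simp add: spanning_tree_def)

lemma Violet_in_nodes [simp]: "Violet v \<in> bip_nodes G \<longleftrightarrow> v \<in> verts G"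
  and Emerald_in_nodes [simp]: "Emerald e \<in> bip_nodes G \<longleftrightarrow> e \<in> edges G"
  by (auto simp: bip_nodes_def violet_def emerald_def)

lemma bip_edges_iff: "(v, e) \<in> bip_edges G \<longleftrightarrow> e \<in> edges G \<and> v \<in> ends G e"
  by (simp add: bip_edges_def)

lemma endpoints_nodes: "a \<in> bip_edges G \<Longrightarrow> endpoints a \<subseteq> bip_nodes G"
  using loopless by (cases a) (auto simp: bip_edges_iff loopless_graph_def)

lemma finite_nodes: "finite (bip_nodes G)"
  using loopless by (simp add: loopless_graph_def bip_nodes_def violet_def emerald_def)

lemma finite_bip_edges: "finite (bip_edges G)"
proof (rule finite_subset)
  show "bip_edges G \<subseteq> verts G \<times> edges G"
    using loopless by (auto simp: bip_edges_def loopless_graph_def)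
qed (use loopless in \<open>simp add: loopless_graph_def\<close>)

lemma finite_T: "finite T"
  using finite_subset[OF T_subset finite_bip_edges] .

lemma T_reach: "x \<in> bip_nodes G \<Longrightarrow> y \<in> bip_nodes G \<Longrightarrow> (adjacent T)\<^sup>*\<^sup>* x y"
  using tree by (simp add: spanning_tree_def)

lemma bridge:
  assumes "a \<in> T" "endpoints a = {x, y}"
  shows "y \<notin> side T a x"
proof
  assume y: "y \<in> side T a x"
  obtain v e where a: "a = (v, e)" by force
  have "(adjacent (T - {(v, e)}))\<^sup>*\<^sup>* (Violet v) (Emerald e)"
    using assms(2) y reach_sym[of "T - {(v, e)}" x y] a by (auto simp: side_def doubleton_eq_iff)
  then show False
    using path_gives_cycle tree a assms(1) by (fastforce simp: spanning_tree_def)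
qed

lemma side_edge_iff: "(w, g) \<in> T \<Longrightarrow> (w, g) \<noteq> a \<Longrightarrow> Violet w \<in> side T a x \<longleftrightarrow> Emerald g \<in> side T a x"
  by (rule edge_closedD[OF side_edge_closed]) auto

lemma side_cover:
  assumes "a \<in> T" "endpoints a = {x, y}" "z \<in> bip_nodes G"
  shows "z \<in> side T a x \<or> z \<in> side T a y"
proof -
  have "edge_closed T (side T a x \<union> side T a y)"
  proof (rule edge_closedI)
    fix v e assume ve: "(v, e) \<in> T"
    show "Violet v \<in> side T a x \<union> side T a y \<longleftrightarrow> Emerald e \<in> side T a x \<union> side T a y"
    proof (cases "(v, e) = a")
      case True
      then have "{Violet v, Emerald e} = {x, y}" using assms(2) True[symmetric] by simp
      then show ?thesis using side_self[of x T a] side_self[of y T a] by (auto simp: doubleton_eq_iff)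
    qed (use side_edge_iff[OF ve, of a x] side_edge_iff[OF ve, of a y] in blast)
  qed
  moreover have "(adjacent T)\<^sup>*\<^sup>* x z"
    using T_reach[of x z] assms endpoints_nodes[of a] T_subset by auto
  ultimately show ?thesis
    using reach_edge_closed side_self[of x T a] by blast
qed

lemma side_disjoint:
  assumes "a \<in> T" "endpoints a = {x, y}"
  shows "side T a x \<inter> side T a y = {}"
proof -
  have "y \<in> side T a x" if "z \<in> side T a x" "z \<in> side T a y" for z
    using that reach_sym[of "T - {a}" y z] by (auto simp: side_def)
  then show ?thesis using bridge[OF assms] by blast
qed

section \<open>Rotation at the nodes\<close>

lemma emerald_ends:
  assumes "(v, e) \<in> bip_edges G"
  obtains u where "u \<noteq> v" "(u, e) \<in> bip_edges G" "ends G e = {u, v}"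
proof -
  have "e \<in> edges G" "v \<in> ends G e" using assms by (auto simp: bip_edges_iff)
  moreover from this have "card (ends G e) = 2" using loopless by (simp add: loopless_graph_def)
  ultimately show ?thesis
    using that unfolding card_2_iff bip_edges_iff by (metis insert_commute insertE singletonD insertI1)
qed

lemma incident_ne: "a \<in> bip_edges G \<Longrightarrow> x \<in> endpoints a \<Longrightarrow> cyclic_on (rib x) (incident (bip_edges G) x)"
  using ribbon endpoints_nodes[of a] unfolding ribbon_structure_def incident_def by blast

lemma rib_incident: "a \<in> incident (bip_edges G) x \<Longrightarrow> rib x a \<in> incident (bip_edges G) x"
  using cyclic_on_inI[OF incident_ne[of a x]] by (auto simp: incident_def)

lemma rib_inj: "inj_on (rib x) (incident (bip_edges G) x)"
proof (cases "incident (bip_edges G) x = {}")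
  case False
  then have c: "cyclic_on (rib x) (incident (bip_edges G) x)"
    using incident_ne by (auto simp: incident_def)
  have "rib x ` incident (bip_edges G) x = incident (bip_edges G) x"
  proof
    show "rib x ` incident (bip_edges G) x \<subseteq> incident (bip_edges G) x"
      using rib_incident by blast
    show "incident (bip_edges G) x \<subseteq> rib x ` incident (bip_edges G) x"
    proof
      fix a assume a: "a \<in> incident (bip_edges G) x"
      then have "a \<in> orbit (rib x) a" "incident (bip_edges G) x = orbit (rib x) a"
        using c by (auto simp: cyclic_on_alldef)
      then show "a \<in> rib x ` incident (bip_edges G) x"
        by (auto elim: orbit.cases)
    qed
  qed
  then show ?thesis
    using finite_cyclic_on[OF c] by (simp add: eq_card_imp_inj_on)
qed simp

lemma incident_emerald:
  assumes "(u, e) \<in> bip_edges G" "(v, e) \<in> bip_edges G" "u \<noteq> v"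
  shows "incident (bip_edges G) (Emerald e) = {(u, e), (v, e)}"
proof -
  obtain w where "ends G e = {w, u}" using emerald_ends[OF assms(1)] by blast
  then have ends: "ends G e = {u, v}" using assms by (auto simp: bip_edges_iff)
  show ?thesis
  proof (rule set_eqI)
    fix b show "b \<in> incident (bip_edges G) (Emerald e) \<longleftrightarrow> b \<in> {(u, e), (v, e)}"
      using assms(1) by (cases b) (auto simp: incident_def bip_edges_iff ends)
  qed
qed

text \<open>Here it matters that hyperedges have two elements: the cyclic order at an emerald node
  just swaps its two edges. The timing arguments below rely on this.\<close>

lemma rib_emerald:
  assumes "(u, e) \<in> bip_edges G" "(v, e) \<in> bip_edges G" "u \<noteq> v"
  shows "rib (Emerald e) (u, e) = (v, e)"
proof -
  have inc: "incident (bip_edges G) (Emerald e) = {(u, e), (v, e)}"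
    using assms by (rule incident_emerald)
  have "cyclic_on (rib (Emerald e)) {(u, e), (v, e)}"
    using incident_ne[of "(u, e)" "Emerald e"] assms(1) inc by simp
  then have orb: "{(u, e), (v, e)} = orbit (rib (Emerald e)) (u, e)"
    by (auto simp: cyclic_on_alldef)
  have "rib (Emerald e) (u, e) \<noteq> (u, e)"
  proof
    assume "rib (Emerald e) (u, e) = (u, e)"
    then have "orbit (rib (Emerald e)) (u, e) = {(u, e)}"
      by (simp add: orbit_eq_singleton_iff)
    then show False using orb assms(3) by auto
  qed
  moreover have "rib (Emerald e) (u, e) \<in> {(u, e), (v, e)}"
    using orb orbit.base by metis
  ultimately show ?thesis by blast
qed

section \<open>The tour as a periodic orbit of darts\<close>

definition darts :: "(('v, 'e) node \<times> ('v, 'e) bedge) set" where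
  "darts = {(x, a). a \<in> bip_edges G \<and> x \<in> endpoints a}"

abbreviation "step \<equiv> tour_step rib T"
abbreviation "len \<equiv> tour_length rib b0 base T"

definition dart_at :: "nat \<Rightarrow> ('v, 'e) node \<times> ('v, 'e) bedge" where
  "dart_at i = (step ^^ i) (b0, base)"

lemma dart_at_0 [simp]: "dart_at 0 = (b0, base)"
  and dart_at_Suc [simp]: "dart_at (Suc i) = step (dart_at i)"
  by (simp_all add: dart_at_def)

lemma finite_darts: "finite darts"
proof (rule finite_subset)
  show "darts \<subseteq> bip_nodes G \<times> bip_edges G"
    using endpoints_nodes by (auto simp: darts_def)
qed (simp add: finite_nodes finite_bip_edges)

lemma step_tree: "a \<in> T \<Longrightarrow> endpoints a = {x, y} \<Longrightarrow> step (x, a) = (y, rib y a)"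
  by (simp add: tour_step_def opposite_eqI)

lemma step_nontree: "a \<notin> T \<Longrightarrow> step (x, a) = (x, rib x a)"
  by (simp add: tour_step_def)

lemma step_darts: "d \<in> darts \<Longrightarrow> step d \<in> darts"
proof -
  assume d: "d \<in> darts"
  obtain x a where xa: "d = (x, a)" using prod.exhaust by blast
  let ?y = "if a \<in> T then opposite x a else x"
  have "a \<in> incident (bip_edges G) ?y"
    using d xa opposite_endpoints[of x a] by (auto simp: darts_def incident_def)
  then have "rib ?y a \<in> incident (bip_edges G) ?y" by (rule rib_incident)
  then show ?thesis using xa by (simp add: darts_def tour_step_def incident_def Let_def)
qed

lemma step_inj: "inj_on step darts"
proof (rule inj_onI)
  fix d d' assume d: "d \<in> darts" "d' \<in> darts" "step d = step d'"
  obtain x a x' a' where xa: "d = (x, a)" "d' = (x', a')" using prod.exhaust by metis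
  define y where "y = (if a \<in> T then opposite x a else x)"
  define y' where "y' = (if a' \<in> T then opposite x' a' else x')"
  have eq: "y = y'" "rib y a = rib y a'"
    using d(3) xa by (auto simp: tour_step_def Let_def y_def y'_def)
  have "a \<in> incident (bip_edges G) y" "a' \<in> incident (bip_edges G) y'"
    using d(1,2) xa opposite_endpoints[of x a] opposite_endpoints[of x' a']
    by (auto simp: darts_def incident_def y_def y'_def)
  then have "a = a'" using eq rib_inj[of y] by (auto dest: inj_onD)
  moreover from this have "x = x'"
  proof (cases "a \<in> T")
    case True
    then have "opposite x a = opposite x' a" using eq(1) \<open>a = a'\<close> by (simp add: y_def y'_def)
    moreover have "x \<in> endpoints a" "x' \<in> endpoints a"
      using d(1,2) xa \<open>a = a'\<close> by (simp_all add: darts_def)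
    ultimately show ?thesis using opposite_endpoints[of x a] opposite_endpoints[of x' a] by blast
  qed (use eq(1) \<open>a = a'\<close> in \<open>simp add: y_def y'_def\<close>)
  ultimately show "d = d'" using xa by simp
qed

lemma dart_at_darts: "dart_at i \<in> darts"
proof (induction i)
  case 0
  show ?case using base_incident by (auto simp: darts_def incident_def)
qed (simp add: step_darts)

text \<open>Injectivity of the step map on darts cancels a common number of steps, so the orbit is
  purely periodic: the first dart to recur is the starting one.\<close>

lemma dart_at_shift: "dart_at (k + i) = dart_at (k + j) \<Longrightarrow> dart_at i = dart_at j"
proof (induction k)
  case (Suc k)
  then have "step (dart_at (k + i)) = step (dart_at (k + j))" by simp
  then have "dart_at (k + i) = dart_at (k + j)"
    using inj_onD[OF step_inj] dart_at_darts by blast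
  then show ?case by (rule Suc.IH)
qed simp

text \<open>\<open>len\<close> is a \<open>LEAST\<close> and needs a witness: among finitely many
  darts the orbit repeats, and cancellation moves the repetition back to the start.\<close>

lemma len_pos: "len > 0" and dart_at_len: "dart_at len = (b0, base)"
  and len_le: "n > 0 \<Longrightarrow> dart_at n = (b0, base) \<Longrightarrow> len \<le> n"
proof -
  have "finite (range dart_at)"
    by (rule finite_subset[OF _ finite_darts]) (use dart_at_darts in auto)
  then have "\<not> inj dart_at"
    using finite_imageD infinite_UNIV_nat by blast
  then obtain i j where "i < j" "dart_at i = dart_at j"
    by (metis injI linorder_neqE_nat)
  then have "dart_at (j - i) = (b0, base)"
    using dart_at_shift[of i 0 "j - i"] by simp
  then have "\<exists>n. n > 0 \<and> (step ^^ n) (b0, base) = (b0, base)"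
    using \<open>i < j\<close> by (intro exI[of _ "j - i"]) (simp add: dart_at_def)
  then have "len > 0 \<and> (step ^^ len) (b0, base) = (b0, base)"
    unfolding tour_length_def by (rule LeastI_ex)
  then show "len > 0" "dart_at len = (b0, base)" by (simp_all add: dart_at_def)
  show "len \<le> n" if "n > 0" "dart_at n = (b0, base)"
    unfolding tour_length_def by (rule Least_le) (use that in \<open>simp add: dart_at_def\<close>)
qed

lemma dart_at_inj: "inj_on dart_at {..<len}"
proof (rule linorder_inj_onI)
  fix i j assume ij: "i < j" "i \<in> {..<len}" "j \<in> {..<len}"
  show "dart_at i \<noteq> dart_at j"
  proof
    assume "dart_at i = dart_at j"
    then have "dart_at (j - i) = (b0, base)"
      using dart_at_shift[of i 0 "j - i"] ij by simp
    then show False using len_le[of "j - i"] ij by auto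
  qed
qed auto

section \<open>Every dart is visited\<close>

lemma visited_step: "d \<in> dart_at ` {..<len} \<Longrightarrow> step d \<in> dart_at ` {..<len}"
proof -
  assume "d \<in> dart_at ` {..<len}"
  then obtain i where i: "i < len" "d = dart_at i" by auto
  show ?thesis
  proof (cases "Suc i = len")
    case True
    then have "step d = dart_at 0" using dart_at_len i by simp (metis dart_at_Suc)
    then show ?thesis using len_pos by blast
  next
    case False
    then show ?thesis using i by (auto intro!: image_eqI[of _ _ "Suc i"])
  qed
qed

text \<open>A step changes its node only along a tree edge, and \<open>a\<close> is the only tree
  edge between the two sides, so only the two darts of \<open>a\<close> can cross.\<close>

lemma step_side:
  assumes "a \<in> T" "endpoints a = {x, y}" "d \<in> darts" "d \<noteq> (x, a)" "d \<noteq> (y, a)"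
  shows "fst (step d) \<in> side T a y \<longleftrightarrow> fst d \<in> side T a y"
proof -
  obtain z b where d: "d = (z, b)" using prod.exhaust by blast
  have zb: "b \<in> bip_edges G" "z \<in> endpoints b" using assms(3) d by (auto simp: darts_def)
  show ?thesis
  proof (cases "b \<in> T")
    case False
    then show ?thesis using d by (simp add: step_nontree)
  next
    case True
    have "b \<noteq> a" using assms zb d by auto
    have "endpoints b = {z, opposite z b}" using opposite_endpoints[OF zb(2)] by simp
    then have "opposite z b \<in> side T a y \<longleftrightarrow> z \<in> side T a y"
      using side_edge_closed[of T a y] True \<open>b \<noteq> a\<close> unfolding edge_closed_def by blast
    then show ?thesis using True d by (simp add: tour_step_def Let_def)
  qed
qed

text \<open>Once the tour has crossed \<open>a\<close> to the side of \<open>y\<close>, the only way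
  back is through \<open>(y, a)\<close>. Without this dart it would stay there forever, although it
  returns to \<open>(x, a)\<close> after one period.\<close>

lemma visited_reverse:
  assumes a: "a \<in> T" "endpoints a = {x, y}" and vis: "(x, a) \<in> dart_at ` {..<len}"
  shows "(y, a) \<in> dart_at ` {..<len}"
proof (rule ccontr)
  assume nv: "(y, a) \<notin> dart_at ` {..<len}"
  obtain i where i: "i < len" "dart_at i = (x, a)" using vis by auto
  have x: "x \<notin> side T a y" using bridge[of a y x] a by (simp add: insert_commute)
  have vis_all: "dart_at j \<in> dart_at ` {..<len}" for j
  proof (induction j)
    case 0
    show ?case using len_pos by blast
  qed (use visited_step in simp)
  have "fst (dart_at (Suc i + k)) \<in> side T a y" for k
  proof (induction k)
    case 0
    show ?case using i a by (simp add: step_tree)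
  next
    case (Suc k)
    then have "dart_at (Suc i + k) \<noteq> (x, a)" using x by force
    moreover have "dart_at (Suc i + k) \<noteq> (y, a)" using nv vis_all[of "Suc i + k"] by force
    ultimately show ?case
      using step_side[OF a dart_at_darts, of "Suc i + k"] Suc by simp
  qed
  from this[of "len - 1"] have "fst (dart_at (i + len)) \<in> side T a y"
    using len_pos by (simp del: dart_at_Suc)
  moreover have "dart_at (i + len) = dart_at i"
    using dart_at_len by (simp add: dart_at_def funpow_add)
  ultimately show False using i x by simp
qed

lemma visited_rotate:
  assumes "(x, a) \<in> dart_at ` {..<len}"
  shows "(x, rib x a) \<in> dart_at ` {..<len}"
proof (cases "a \<in> T")
  case True
  have "(x, a) \<in> darts" using assms dart_at_darts by auto
  then have "endpoints a = {x, opposite x a}"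
    using opposite_endpoints[of x a] by (auto simp: darts_def)
  then show ?thesis
    using visited_step[OF visited_reverse[OF True _ assms]] step_tree[OF True, of "opposite x a" x]
    by (metis insert_commute)
qed (use visited_step[OF assms] in \<open>simp add: step_nontree\<close>)

lemma visited_node:
  assumes "(x, a) \<in> dart_at ` {..<len}" "b \<in> incident (bip_edges G) x"
  shows "(x, b) \<in> dart_at ` {..<len}"
proof -
  have "(x, a) \<in> darts" using assms dart_at_darts by auto
  then have "a \<in> incident (bip_edges G) x" "cyclic_on (rib x) (incident (bip_edges G) x)"
    using incident_ne[of a x] by (auto simp: darts_def incident_def)
  then have "b \<in> orbit (rib x) a"
    using assms(2) unfolding cyclic_on_alldef by blast
  then show ?thesis
    by induction (use assms(1) visited_rotate in blast)+
qed

text \<open>The nodes with a visited dart form a set closed under \<open>T\<close>: rotation reaches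
  every edge at such a node, reversal the other end of each tree edge. Connectedness of
  \<open>T\<close> does the rest.\<close>

lemma visited_all: "d \<in> darts \<Longrightarrow> d \<in> dart_at ` {..<len}"
proof -
  assume d: "d \<in> darts"
  obtain x b where xb: "d = (x, b)" using prod.exhaust by blast
  let ?X = "{x. \<exists>a. (x, a) \<in> dart_at ` {..<len}}"
  have "edge_closed T ?X"
    unfolding edge_closed_def
  proof (intro ballI impI)
    fix a assume a: "a \<in> T" "endpoints a \<inter> ?X \<noteq> {}"
    then obtain z c where z: "z \<in> endpoints a" "(z, c) \<in> dart_at ` {..<len}" by blast
    then have za: "(z, a) \<in> dart_at ` {..<len}"
      using visited_node[OF z(2), of a] a(1) z(1) T_subset unfolding incident_def by blast
    have ep: "endpoints a = {z, opposite z a}" using opposite_endpoints[OF z(1)] by simp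
    have "z \<in> ?X" "opposite z a \<in> ?X" using za visited_reverse[OF a(1) ep za] by blast+
    then show "endpoints a \<subseteq> ?X" by (subst ep) blast
  qed
  moreover have "(b0, base) \<in> dart_at ` {..<len}"
    using len_pos by (intro image_eqI[of _ _ 0]) simp_all
  then have "b0 \<in> ?X" by blast
  moreover have xn: "x \<in> bip_nodes G" "b \<in> incident (bip_edges G) x"
    using d xb endpoints_nodes[of b] unfolding darts_def incident_def by auto
  ultimately have "x \<in> ?X"
    using reach_edge_closed T_reach[OF b0_node xn(1)] by blast
  then show ?thesis using visited_node xn(2) xb by blast
qed

section \<open>Visit times\<close>

definition pos :: "('v, 'e) node \<times> ('v, 'e) bedge \<Rightarrow> nat" where
  "pos = inv_into {..<len} dart_at"

lemma dart_at_pos: "d \<in> darts \<Longrightarrow> dart_at (pos d) = d"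
  and pos_less: "d \<in> darts \<Longrightarrow> pos d < len"
  using visited_all[of d] inv_into_into[of d dart_at "{..<len}"]
  by (auto simp: pos_def f_inv_into_f)

lemma pos_dart_at: "i < len \<Longrightarrow> pos (dart_at i) = i"
  by (simp add: pos_def inv_into_f_f dart_at_inj)

lemma pos_base: "pos (b0, base) = 0"
  using pos_dart_at[of 0] len_pos by simp

lemma pos_inj: "d \<in> darts \<Longrightarrow> d' \<in> darts \<Longrightarrow> pos d = pos d' \<longleftrightarrow> d = d'"
  by (metis dart_at_pos)

lemma pos_step: "d \<in> darts \<Longrightarrow> step d \<noteq> (b0, base) \<Longrightarrow> pos (step d) = Suc (pos d)"
proof -
  assume d: "d \<in> darts" "step d \<noteq> (b0, base)"
  have "dart_at (Suc (pos d)) = step d" using d by (simp add: dart_at_pos)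
  moreover have "Suc (pos d) \<noteq> len" using d(2) dart_at_len calculation by metis
  ultimately show ?thesis
    using pos_less[OF d(1)] pos_dart_at[of "Suc (pos d)"] by simp
qed

lemma precedes_iff: "d \<in> darts \<Longrightarrow> d' \<in> darts \<Longrightarrow> precedes rib b0 base T d d' \<longleftrightarrow> pos d < pos d'"
proof -
  assume d: "d \<in> darts" "d' \<in> darts"
  have tour: "length (tour rib b0 base T) = len" "\<And>i. i < len \<Longrightarrow> tour rib b0 base T ! i = dart_at i"
    by (simp_all add: tour_def dart_at_def)
  show ?thesis
  proof
    assume "precedes rib b0 base T d d'"
    then obtain i j where "i < j" "j < len" "dart_at i = d" "dart_at j = d'"
      using tour by (auto simp: precedes_def)
    then show "pos d < pos d'" using pos_dart_at by auto
  next
    assume "pos d < pos d'"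
    then show "precedes rib b0 base T d d'"
      unfolding precedes_def using tour d pos_less dart_at_pos
      by (intro exI[of _ "pos d"] exI[of _ "pos d'"]) auto
  qed
qed

lemma dart_Violet: "(v, e) \<in> bip_edges G \<Longrightarrow> (Violet v, (v, e)) \<in> darts"
  and dart_Emerald: "(v, e) \<in> bip_edges G \<Longrightarrow> (Emerald e, (v, e)) \<in> darts"
  by (auto simp: darts_def)

lemma cut_pos:
  assumes "(w, g) \<in> bip_edges G" "(w, g) \<notin> T"
  shows "pos (Violet w, (w, g)) < pos (Emerald g, (w, g))"
proof -
  have "opposite (Violet w) (w, g) = Emerald g" by (rule opposite_eqI) simp
  then have "precedes rib b0 base T (Violet w, (w, g)) (Emerald g, (w, g))"
    using cut_at_violet[OF assms] by (simp add: cut_at_def)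
  then show ?thesis using precedes_iff dart_Violet dart_Emerald assms(1) by blast
qed

text \<open>Starting outside the side of \<open>y\<close>, the tour enters it only by the step after
  \<open>(x, a)\<close> and leaves it only by the step after \<open>(y, a)\<close>. Each dart occurs
  once per period, so the visits form one interval, open on the left and closed on the
  right.\<close>

lemma pos_side:
  assumes a: "a \<in> T" "endpoints a = {x, y}" and b0: "b0 \<notin> side T a y" and d: "d \<in> darts"
  shows "fst d \<in> side T a y \<longleftrightarrow> pos (x, a) < pos d \<and> pos d \<le> pos (y, a)"
proof -
  let ?D = "side T a y" and ?s = "pos (x, a)" and ?t = "pos (y, a)"
  have darts: "(x, a) \<in> darts" "(y, a) \<in> darts"
    using a T_subset by (auto simp: darts_def)
  have ends: "x \<notin> ?D" "y \<in> ?D"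
    using bridge[of a y x] a by (simp_all add: insert_commute)
  have at: "dart_at ?s = (x, a)" "dart_at ?t = (y, a)" and lt: "?s < len" "?t < len"
    using darts by (simp_all add: dart_at_pos pos_less)
  have at_iff: "dart_at i = (x, a) \<longleftrightarrow> i = ?s" "dart_at i = (y, a) \<longleftrightarrow> i = ?t" if "i < len" for i
    using that at pos_dart_at by metis+
  have keep: "fst (dart_at (Suc i)) \<in> ?D \<longleftrightarrow> fst (dart_at i) \<in> ?D" if "i < len" "i \<noteq> ?s" "i \<noteq> ?t" for i
    using step_side[OF a dart_at_darts, of i] that at_iff by auto
  have before: "fst (dart_at i) \<notin> ?D" if "i \<le> ?s" for i
    using that
  proof (induction i)
    case (Suc i)
    then have "i \<noteq> ?t" using at ends by force
    then show ?case using Suc keep[of i] lt by simp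
  qed (use b0 in simp)
  then have "?s < ?t" using at ends by (metis fst_conv not_le)
  have inside: "fst (dart_at i) \<in> ?D" if "Suc ?s \<le> i" "i \<le> ?t" for i
    using that
  proof (induction i rule: dec_induct)
    case base
    show ?case using at a by (simp add: step_tree)
  next
    case (step i)
    then show ?case using keep[of i] lt by simp
  qed
  have after: "fst (dart_at i) \<notin> ?D" if "Suc ?t \<le> i" "i < len" for i
    using that
  proof (induction i rule: dec_induct)
    case base
    show ?case using at a ends step_tree[of a y x] by (simp add: insert_commute)
  next
    case (step i)
    then show ?case using keep[of i] \<open>?s < ?t\<close> by simp
  qed
  show ?thesis
    using before[of "pos d"] inside[of "pos d"] after[of "pos d"] d
    by (simp add: dart_at_pos pos_less) linarith
qed

subsection \<open>Parents with respect to the first violet node\<close>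

text \<open>If \<open>b0\<close> is emerald, then \<open>base\<close> cannot be cut at its violet end and hence lies in \<open>T\<close>; so the tour
  reaches this violet end first in either case.\<close>

definition root :: "('v, 'e) node" where
  "root = Violet (fst base)"

lemma base_edge: "base \<in> bip_edges G" "b0 \<in> endpoints base"
  using base_incident by (auto simp: incident_def)

lemma endpoints_base: "endpoints base = {root, Emerald (snd base)}"
  unfolding root_def by (metis endpoints_pair prod.collapse)

lemma root_node: "root \<in> bip_nodes G"
  using endpoints_nodes[OF base_edge(1)] endpoints_base by simp

lemma b0_cases:
  obtains "b0 = root" | e where "b0 = Emerald e" "base = (fst base, e)" "base \<in> T"
proof (cases b0)
  case (Violet v)
  then show ?thesis using that(1) base_edge(2) endpoints_base by auto
next
  case (Emerald e)
  then have base: "base = (fst base, e)" using base_edge(2) endpoints_base by (auto simp: root_def prod_eq_iff)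
  have "base \<in> T"
  proof (rule ccontr)
    assume "base \<notin> T"
    then have "pos (Violet (fst base), base) < pos (b0, base)"
      using cut_pos[of "fst base" e, folded base] base_edge(1) Emerald by simp
    then show False by (simp add: pos_base)
  qed
  then show ?thesis using that(2) Emerald base by blast
qed

text \<open>\<open>e\<close> is the parent of \<open>v\<close>: the condition on \<open>root\<close>
  directs the tree edge, \<open>u\<close> is the next node towards \<open>root\<close>, and the side
  of \<open>v\<close> is the subtree hanging at \<open>v\<close>.\<close>

definition child :: "'v \<Rightarrow> 'e \<Rightarrow> bool" where
  "child v e \<longleftrightarrow> (v, e) \<in> T \<and> (\<exists>u. u \<noteq> v \<and> (u, e) \<in> T) \<and> root \<notin> side T (v, e) (Violet v)"

text \<open>The direction matters: \<open>(v, e)\<close> itself has its violet end inside the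
  subtree and its emerald end outside, and such edges do not count.\<close>

definition entered :: "'v \<Rightarrow> 'e \<Rightarrow> bool" where
  "entered v e \<longleftrightarrow> (\<exists>w g. (w, g) \<in> bip_edges G \<and>
     Violet w \<notin> side T (v, e) (Violet v) \<and> Emerald g \<in> side T (v, e) (Violet v))"

lemma side_nodes:
  assumes "x \<in> bip_nodes G"
  shows "side T a x \<subseteq> bip_nodes G"
proof
  fix z assume "z \<in> side T a x"
  moreover have "edge_closed (T - {a}) (bip_nodes G)"
    using endpoints_nodes T_subset by (auto simp: edge_closed_def)
  ultimately show "z \<in> bip_nodes G"
    using reach_edge_closed assms unfolding side_def by blast
qed

lemma T_bip: "a \<in> T \<Longrightarrow> a \<in> bip_edges G"
  using T_subset by blast

lemma T_nodes: "(v, e) \<in> T \<Longrightarrow> Violet v \<in> bip_nodes G \<and> Emerald e \<in> bip_nodes G"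
  using T_bip endpoints_nodes by fastforce

lemma edge_closed_all:
  assumes "edge_closed T X" "x \<in> X" "x \<in> bip_nodes G" "z \<in> bip_nodes G"
  shows "z \<in> X"
  using reach_edge_closed[OF T_reach] assms by blast

lemma emerald_outside: "(v, e) \<in> T \<Longrightarrow> Emerald e \<notin> side T (v, e) (Violet v)"
  by (rule bridge) simp_all

lemma parent_outside: "(v, e) \<in> T \<Longrightarrow> (u, e) \<in> T \<Longrightarrow> u \<noteq> v \<Longrightarrow> Violet u \<notin> side T (v, e) (Violet v)"
  using emerald_outside side_edge_iff[of u e "(v, e)"] by blast

text \<open>An edge that misses \<open>X \<inter> Y\<close> cannot violate closure, so
  \<open>a\<close> and \<open>b\<close> may be put back. As \<open>T\<close> is connected, this
  refutes two sides that share \<open>root\<close> but omit a common node.\<close>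

lemma edge_closed_Int:
  assumes "edge_closed (T - {a}) X" "edge_closed (T - {b}) Y"
    and "endpoints a \<inter> (X \<inter> Y) = {}" "endpoints b \<inter> (X \<inter> Y) = {}"
  shows "edge_closed T (X \<inter> Y)"
  using assms unfolding edge_closed_def by blast

text \<open>If two tree edges both led from \<open>x\<close> towards \<open>root\<close>, the sides
  containing \<open>root\<close> would both omit \<open>x\<close>, while their intersection is
  closed under \<open>T\<close>.\<close>

lemma parent_edge_unique:
  assumes a: "a \<in> T" "endpoints a = {y, x}" "root \<in> side T a y"
    and b: "b \<in> T" "endpoints b = {z, x}" "root \<in> side T b z"
  shows "a = b"
proof (rule ccontr)
  assume ne: "a \<noteq> b"
  let ?X = "side T a y" and ?Y = "side T b z"
  have x: "x \<notin> ?X" "x \<notin> ?Y" using bridge a b by blast+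
  have "y \<notin> ?Y"
    using side_edge_closed[of T b z] a(1,2) ne x(2) unfolding edge_closed_def by blast
  moreover have "z \<notin> ?X"
    using side_edge_closed[of T a y] b(1,2) ne x(1) unfolding edge_closed_def by blast
  ultimately have "edge_closed T (?X \<inter> ?Y)"
    using x a(2) b(2) by (intro edge_closed_Int[OF side_edge_closed side_edge_closed]) auto
  moreover have "x \<in> bip_nodes G" using a endpoints_nodes T_bip by blast
  ultimately have "x \<in> ?X \<inter> ?Y"
    using edge_closed_all[of "?X \<inter> ?Y" root x] a(3) b(3) root_node by blast
  then show False using x by blast
qed

lemma child_unique_emerald:
  assumes "child v e" "child v e'"
  shows "e = e'"
proof -
  have "root \<in> side T (v, d) (Emerald d)" "(v, d) \<in> T" if "child v d" for d
    using that side_cover[of "(v, d)" "Emerald d" "Violet v" root] root_node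
    by (auto simp: child_def insert_commute)
  then have "(v, e) = (v, e')"
    using assms parent_edge_unique[of "(v, e)" "Emerald e" "Violet v" "(v, e')" "Emerald e'"]
    by (simp add: insert_commute)
  then show ?thesis by simp
qed

text \<open>If both neighbours of \<open>e\<close> lay away from \<open>root\<close>, then
  \<open>e\<close> and the two subtrees behind them would form a set closed under \<open>T\<close>
  that omits \<open>root\<close>.\<close>

lemma child_unique_violet:
  assumes "child v e" "child u e"
  shows "v = u"
proof (rule ccontr)
  assume ne: "v \<noteq> u"
  have T: "(v, e) \<in> T" "(u, e) \<in> T" using assms by (auto simp: child_def)
  let ?X = "insert (Emerald e) (side T (v, e) (Violet v) \<union> side T (u, e) (Violet u))"
  have "edge_closed T ?X"
  proof (rule edge_closedI)
    fix w g assume wg: "(w, g) \<in> T"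
    show "Violet w \<in> ?X \<longleftrightarrow> Emerald g \<in> ?X"
    proof (cases "g = e")
      case True
      then have "(w, g) \<in> incident (bip_edges G) (Emerald e)"
        using wg T_bip by (simp add: incident_Emerald)
      then have "(w, g) \<in> {(v, e), (u, e)}"
        by (simp only: incident_emerald[OF T_bip[OF T(1)] T_bip[OF T(2)] ne])
      then show ?thesis using True by auto
    next
      case False
      then show ?thesis
        using side_edge_iff[OF wg, of "(v, e)"] side_edge_iff[OF wg, of "(u, e)"] by auto
    qed
  qed
  then have "root \<in> ?X"
    using edge_closed_all[of ?X "Emerald e" root] root_node T_nodes T by blast
  then show False using assms by (auto simp: child_def root_def)
qed

lemma child_of_emerald:
  assumes "(u, e) \<in> T" "(v, e) \<in> T" "u \<noteq> v"
  shows "child u e \<or> child v e"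
proof (rule ccontr)
  assume "\<not> ?thesis"
  then have root: "root \<in> side T (u, e) (Violet u) \<inter> side T (v, e) (Violet v)" (is "_ \<in> ?X \<inter> ?Y")
    using assms by (auto simp: child_def)
  have out: "Emerald e \<notin> ?X" "Violet v \<notin> ?X" "Violet u \<notin> ?Y"
    using emerald_outside parent_outside assms by blast+
  then have "edge_closed T (?X \<inter> ?Y)"
    by (intro edge_closed_Int[OF side_edge_closed side_edge_closed]) auto
  then have "Emerald e \<in> ?X \<inter> ?Y"
    using edge_closed_all[of "?X \<inter> ?Y" root "Emerald e"] root root_node T_nodes assms(1) by blast
  then show False using out by blast
qed

text \<open>\<open>v\<close> and the parts beyond its tree edges form a set closed under
  \<open>T\<close>, so one of these parts contains \<open>root\<close>; the edge leading there is
  the parent edge.\<close>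

lemma child_of_violet:
  assumes "v \<in> verts G" "Violet v \<noteq> root"
  obtains e where "child v e"
proof -
  let ?X = "insert (Violet v) (\<Union>e\<in>{e. (v, e) \<in> T}. side T (v, e) (Emerald e))"
  have "edge_closed T ?X"
  proof (rule edge_closedI)
    fix w g assume wg: "(w, g) \<in> T"
    show "Violet w \<in> ?X \<longleftrightarrow> Emerald g \<in> ?X"
    proof (cases "w = v")
      case True
      then show ?thesis using wg side_self[of "Emerald g" T "(v, g)"] by blast
    next
      case False
      then have "Violet w \<in> side T (v, e) (Emerald e) \<longleftrightarrow> Emerald g \<in> side T (v, e) (Emerald e)" for e
        using side_edge_iff[OF wg, of "(v, e)"] by blast
      then show ?thesis using False by blast
    qed
  qed
  then have "root \<in> ?X"
    using edge_closed_all[of ?X "Violet v" root] root_node assms(1) by simp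
  then obtain e where e: "(v, e) \<in> T" "root \<in> side T (v, e) (Emerald e)"
    using assms(2) by auto
  have "root \<notin> side T (v, e) (Violet v)"
    using side_disjoint[of "(v, e)" "Violet v" "Emerald e"] e by auto
  \<comment> \<open>A path from \<open>e\<close> to \<open>root\<close> avoiding
    \<open>(v, e)\<close> must start with another edge \<open>(u, e)\<close>, which supplies the
    second neighbour of \<open>e\<close>.\<close>
  moreover have "(adjacent (T - {(v, e)}))\<^sup>*\<^sup>* (Emerald e) root"
    using e(2) by (simp add: side_def)
  then have "\<exists>u. u \<noteq> v \<and> (u, e) \<in> T"
    by (cases rule: converse_rtranclpE) (auto simp: root_def adjacent_iff)
  ultimately show ?thesis using that e(1) by (auto simp: child_def)
qed

section \<open>Visit times and violet order around a subtree\<close>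

lemma b0_outside:
  assumes "child v e"
  shows "b0 \<notin> side T (v, e) (Violet v)"
proof (cases rule: b0_cases)
  case (2 g)
  \<comment> \<open>In this case \<open>b0\<close> is the emerald end of the tree edge
    \<open>base\<close>, whose violet end is \<open>root\<close>. As \<open>base\<close> is not
    \<open>(v, e)\<close>, both ends lie on the same side.\<close>
  have "(fst base, g) \<noteq> (v, e)"
    using assms by (auto simp: child_def root_def)
  then show ?thesis
    using side_edge_iff[of "fst base" g "(v, e)" "Violet v"] 2 assms by (auto simp: child_def root_def)
qed (use assms in \<open>simp add: child_def\<close>)

lemma pos_child:
  assumes "child v e" "d \<in> darts"
  shows "fst d \<in> side T (v, e) (Violet v) \<longleftrightarrow>
    pos (Emerald e, (v, e)) < pos d \<and> pos d \<le> pos (Violet v, (v, e))"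
  using pos_side[OF _ _ b0_outside[OF assms(1)] assms(2)] assms(1)
  by (auto simp: child_def insert_commute)

text \<open>From \<open>u\<close> the tour crosses to \<open>e\<close>, where the swap turns it to
  \<open>(v, e)\<close>; this is the last moment before it enters the subtree.\<close>

lemma pos_parent:
  assumes "child v e" "(u, e) \<in> T" "u \<noteq> v"
  shows "pos (Emerald e, (v, e)) = Suc (pos (Violet u, (u, e)))"
proof -
  have T: "(v, e) \<in> T" using assms by (simp add: child_def)
  have st: "step (Violet u, (u, e)) = (Emerald e, (v, e))"
    using step_tree[OF assms(2), of "Violet u" "Emerald e"] rib_emerald[of u e v] assms T T_bip by simp
  \<comment> \<open>The step does not wrap around to time 0: were \<open>base\<close> equal to
    \<open>(v, e)\<close>, then \<open>root\<close> would be \<open>Violet v\<close>.\<close>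
  moreover have "(Emerald e, (v, e)) \<noteq> (b0, base)"
    using assms(1) by (auto simp: child_def root_def)
  ultimately show ?thesis using pos_step[of "(Violet u, (u, e))"] dart_Violet T_bip assms(2) by simp
qed

lemma violet_less_iff:
  "violet_less G rib b0 base T x y \<longleftrightarrow> (\<exists>a\<in>incident (bip_edges G) x. \<forall>a'\<in>incident (bip_edges G) y.
     pos (Violet (fst a), a) < pos (Violet (fst a'), a'))"
proof -
  have "violet_edge_less rib b0 base T a a' \<longleftrightarrow> pos (Violet (fst a), a) < pos (Violet (fst a'), a')"
    if "a \<in> bip_edges G" "a' \<in> bip_edges G" for a a'
    using that precedes_iff dart_Violet by (cases a, cases a') (simp add: violet_edge_less_def)
  then show ?thesis by (auto simp: violet_less_def incident_def)
qed

text \<open>The tour enters the subtree at \<open>v\<close>: the step after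
  \<open>(Emerald e, (v, e))\<close> gives a dart at \<open>v\<close>, and no dart in the subtree is
  earlier.\<close>

lemma not_less_inside:
  assumes "child v e" "Violet w \<in> side T (v, e) (Violet v)"
  shows "\<not> violet_less G rib b0 base T (Violet w) (Violet v)"
proof
  assume "violet_less G rib b0 base T (Violet w) (Violet v)"
  then obtain a where a: "a \<in> bip_edges G" "fst a = w"
    and less: "\<And>a'. a' \<in> incident (bip_edges G) (Violet v) \<Longrightarrow> pos (Violet w, a) < pos (Violet v, a')"
    by (auto simp: violet_less_iff incident_Violet)
  have T: "(v, e) \<in> T" using assms by (simp add: child_def)
  let ?r = "rib (Violet v) (v, e)"
  have st: "step (Emerald e, (v, e)) = (Violet v, ?r)"
    using step_tree[OF T, of "Emerald e" "Violet v"] by (simp add: insert_commute)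
  have "(Violet v, ?r) \<noteq> (b0, base)"
    using b0_outside[OF assms(1)] by auto
  then have "pos (Violet v, ?r) = Suc (pos (Emerald e, (v, e)))"
    using pos_step[of "(Emerald e, (v, e))"] dart_Emerald T_bip T st by simp
  moreover have "?r \<in> incident (bip_edges G) (Violet v)"
    using rib_incident[of "(v, e)" "Violet v"] T T_bip by (simp add: incident_def)
  moreover have "pos (Emerald e, (v, e)) < pos (Violet w, a)"
    using pos_child[OF assms(1), of "(Violet w, a)"] assms(2) a dart_Violet[of w "snd a"] by auto
  ultimately show False using less by fastforce
qed

text \<open>Some dart at \<open>root\<close> has time 0 or 1, and in the latter case the dart at
  time 0 is emerald; so no violet dart precedes all darts at \<open>root\<close>.\<close>

lemma not_less_root: "\<not> violet_less G rib b0 base T (Violet w) root"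
proof -
  have "\<exists>a'\<in>incident (bip_edges G) root. pos (root, a') \<le> pos (Violet w, a)"
    if a: "a \<in> incident (bip_edges G) (Violet w)" for a
  proof (cases rule: b0_cases)
    case 1
    then show ?thesis using base_incident pos_base by (intro bexI[of _ base]) auto
  next
    case (2 e)
    have ep: "endpoints base = {b0, root}" using 2 endpoints_pair[of "fst base" e] by (auto simp: root_def)
    have "step (b0, base) = (root, rib root base)" using step_tree[OF 2(3) ep] .
    moreover have "(root, rib root base) \<noteq> (b0, base)" using 2 by (simp add: root_def)
    moreover have "(b0, base) \<in> darts" using base_edge by (simp add: darts_def)
    ultimately have "pos (root, rib root base) = 1"
      using pos_step[of "(b0, base)"] pos_base by simp
    moreover have "rib root base \<in> incident (bip_edges G) root"
      using rib_incident[of base root] base_edge(1) ep by (simp add: incident_def)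
    moreover have "(Violet w, a) \<in> darts" using a by (simp add: darts_def incident_def)
    then have "pos (Violet w, a) \<noteq> 0"
      using pos_inj[of "(Violet w, a)" "(b0, base)"] \<open>(b0, base) \<in> darts\<close> 2 pos_base by auto
    ultimately show ?thesis by (metis One_nat_def Suc_leI not_gr_zero)
  qed
  then show ?thesis
    unfolding violet_less_iff root_def by (fastforce simp: incident_Violet not_less)
qed

subsection \<open>Internally inactive nodes\<close>

lemma finite_spanning_tree: "spanning_tree G S \<Longrightarrow> finite S"
  by (rule finite_subset[OF _ finite_bip_edges]) (simp add: spanning_tree_def)

lemma degree_pos:
  assumes "spanning_tree G S" "x \<in> bip_nodes G"
  shows "card (incident S x) \<ge> 1"
proof -
  obtain y where y: "y \<in> bip_nodes G" "y \<noteq> x"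
    using endpoints_nodes[OF base_edge(1)] endpoints_base
    by (metis insert_subset node.distinct(1) root_def)
  have "(adjacent S)\<^sup>*\<^sup>* x y" using assms y by (simp add: spanning_tree_def)
  then obtain z where "adjacent S x z" using y(2) by (auto elim: converse_rtranclpE)
  then have "incident S x \<noteq> {}" unfolding adjacent_def incident_def by blast
  moreover have "finite S" using assms(1) by (rule finite_spanning_tree)
  ultimately show ?thesis by (simp add: incident_def card_gt_0_iff Suc_le_eq)
qed

section \<open>Exchanging the parent edge for an entering edge\<close>

lemma entering_nontree:
  assumes "(v, e) \<in> T" "Violet w \<notin> side T (v, e) (Violet v)" "Emerald g \<in> side T (v, e) (Violet v)"
  shows "(w, g) \<notin> T" "w \<noteq> v" "g \<noteq> e"
  using assms side_edge_iff[of w g "(v, e)" "Violet v"] emerald_outside[of v e]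
  by auto

lemma spanning_tree_exchange:
  assumes "(v, e) \<in> T" "(w, g) \<in> bip_edges G"
    and out: "Violet w \<notin> side T (v, e) (Violet v)" and "in": "Emerald g \<in> side T (v, e) (Violet v)"
  shows "spanning_tree G (insert (w, g) (T - {(v, e)}))" (is "spanning_tree G ?S")
  unfolding spanning_tree_def
proof (intro conjI ballI)
  show "?S \<subseteq> bip_edges G" using assms T_subset by auto
  show "\<nexists>xs. is_cycle ?S xs"
  proof
    assume "\<exists>xs. is_cycle ?S xs"
    then obtain xs where "is_cycle ?S xs" ..
    then have "is_cycle T xs"
      by (rule cycle_exchange[OF _ side_edge_closed[of T "(v, e)" "Violet v"], where p = "Emerald g" and q = "Violet w"])
        (use out "in" in \<open>simp_all add: insert_commute\<close>)
    then show False using tree by (auto simp: spanning_tree_def)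
  qed
  have mono: "(adjacent ?S)\<^sup>*\<^sup>* x y" if "y \<in> side T (v, e) x" for x y
    using that by (auto simp: side_def intro: reach_mono)
  have cover: "z \<in> side T (v, e) (Violet v) \<or> z \<in> side T (v, e) (Emerald e)" if "z \<in> bip_nodes G" for z
    using side_cover[of "(v, e)"] assms(1) that by simp
  have w: "Violet w \<in> side T (v, e) (Emerald e)"
    using cover out assms(2) endpoints_nodes by fastforce
  \<comment> \<open>The walk from \<open>v\<close> to \<open>g\<close>, over the new edge to
    \<open>w\<close> and on to \<open>e\<close> replaces the deleted edge.\<close>
  have "(adjacent ?S)\<^sup>*\<^sup>* (Violet v) (Emerald g)" using mono "in" .
  also have "adjacent ?S (Emerald g) (Violet w)" by (auto simp: adjacent_iff)
  also (rtranclp.rtrancl_into_rtrancl) have "(adjacent ?S)\<^sup>*\<^sup>* (Violet w) (Emerald e)"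
    using mono[OF w] by (rule reach_sym)
  finally (rtranclp_trans) have e: "(adjacent ?S)\<^sup>*\<^sup>* (Violet v) (Emerald e)" .
  have "(adjacent ?S)\<^sup>*\<^sup>* (Violet v) z" if "z \<in> bip_nodes G" for z
    using cover[OF that] mono e rtranclp_trans by metis
  then show "(adjacent ?S)\<^sup>*\<^sup>* x y" if "x \<in> bip_nodes G" "y \<in> bip_nodes G" for x y
    using that reach_sym rtranclp_trans by metis
qed

text \<open>One exchange serves both color classes, which the disjunction treats together:
  \<open>v\<close> and \<open>e\<close> lose an edge, \<open>w\<close> and \<open>g\<close> gain
  one. Nonnegativity comes from the positive degrees in the new tree.\<close>

lemma exchange_hypertree:
  assumes T: "(v, e) \<in> T" and wg: "(w, g) \<in> bip_edges G"
    and out: "Violet w \<notin> side T (v, e) (Violet v)" and "in": "Emerald g \<in> side T (v, e) (Violet v)"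
    and X: "X = violet G \<and> x = Violet v \<and> x' = Violet w \<or> X = emerald G \<and> x = Emerald e \<and> x' = Emerald g"
  shows "hypertree G X ((tree_hypertree T)(x := tree_hypertree T x - 1, x' := tree_hypertree T x' + 1))"
    (is "hypertree G X ?f")
proof -
  let ?S = "insert (w, g) (T - {(v, e)})"
  note ne = entering_nontree[OF T out "in"]
  have st: "spanning_tree G ?S" using spanning_tree_exchange T wg out "in" .
  have deg: "int (card (incident ?S y)) = ?f y + 1" if "y \<in> X" for y
  proof -
    have "y \<in> bip_nodes G" using X that by (auto simp: bip_nodes_def)
    then have deg: "card (incident T y) \<ge> 1" by (rule degree_pos[OF tree])
    have fin: "finite (incident T y)" using finite_T by (simp add: incident_def)
    have "incident ?S y = (if y \<in> endpoints (w, g) then insert (w, g) (incident T y - {(v, e)})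
        else incident T y - {(v, e)})"
      by (auto simp: incident_def)
    moreover have "(w, g) \<notin> incident T y" using ne by (simp add: incident_def)
    ultimately have "card (incident ?S y) =
        card (incident T y - {(v, e)}) + (if y \<in> endpoints (w, g) then 1 else 0)"
      using fin by simp
    moreover have "int (card (incident T y - {(v, e)})) =
        int (card (incident T y)) - (if y \<in> endpoints (v, e) then 1 else 0)"
    proof (cases "y \<in> endpoints (v, e)")
      case True
      then have "(v, e) \<in> incident T y" using T by (simp add: incident_def)
      then show ?thesis using True deg by (simp add: of_nat_diff)
    qed (auto simp: incident_def)
    ultimately have "int (card (incident ?S y)) = int (card (incident T y))
        - (if y \<in> endpoints (v, e) then 1 else 0) + (if y \<in> endpoints (w, g) then 1 else 0)"
      by simp
    then show ?thesis
      using X that ne by (auto simp: tree_hypertree_def violet_def emerald_def)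
  qed
  have "?f y \<ge> 0" if "y \<in> X" for y
  proof -
    have "y \<in> bip_nodes G" using X that by (auto simp: bip_nodes_def)
    then show ?thesis using deg[OF that] degree_pos[OF st, of y] by linarith
  qed
  then show ?thesis using st deg unfolding hypertree_def by blast
qed

text \<open>As \<open>(w, g)\<close> is cut at \<open>w\<close>, its violet dart precedes its
  emerald dart, which lies in the interval of the subtree. The violet dart is outside this interval,
  hence before it.\<close>

lemma entering_pos:
  assumes c: "child v e" "(u, e) \<in> T" "u \<noteq> v" and wg: "(w, g) \<in> bip_edges G"
    and out: "Violet w \<notin> side T (v, e) (Violet v)" and "in": "Emerald g \<in> side T (v, e) (Violet v)"
  shows "pos (Violet w, (w, g)) < pos (Violet u, (u, e))"
proof -
  have T: "(v, e) \<in> T" using c by (simp add: child_def)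
  note ne = entering_nontree[OF T out "in"]
  note darts = dart_Violet[OF wg] dart_Emerald[OF wg]
  have "pos (Violet w, (w, g)) < pos (Emerald g, (w, g))" using cut_pos wg ne by blast
  moreover have "pos (Emerald g, (w, g)) \<le> pos (Violet v, (v, e))"
    using pos_child[OF c(1) darts(2)] "in" by simp
  ultimately have "pos (Violet w, (w, g)) \<le> pos (Emerald e, (v, e))"
    using pos_child[OF c(1) darts(1)] out by simp
  \<comment> \<open>Node color excludes equality here, and \<open>g \<noteq> e\<close> excludes it
    next; so the dart comes even before \<open>(Violet u, (u, e))\<close>, one moment
    earlier.\<close>
  moreover have "pos (Violet w, (w, g)) \<noteq> pos (Emerald e, (v, e))"
    using pos_inj[OF darts(1) dart_Emerald[OF T_bip[OF T]]] by simp
  moreover have "pos (Violet w, (w, g)) \<noteq> pos (Violet u, (u, e))"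
    using pos_inj[OF darts(1) dart_Violet[OF T_bip[OF c(2)]]] ne by simp
  ultimately show ?thesis using pos_parent[OF c] by simp
qed

text \<open>The violet dart of \<open>(w, g)\<close> precedes all darts at \<open>v\<close>, which
  lie in the subtree interval, and both violet darts of \<open>e\<close>, namely those of
  \<open>(u, e)\<close> and \<open>(v, e)\<close>.\<close>

lemma entered_inactive:
  assumes c: "child v e" and "entered v e"
  shows "internally_inactive G (violet G) (violet_less G rib b0 base T) (tree_hypertree T) (Violet v)"
    and "internally_inactive G (emerald G) (violet_less G rib b0 base T) (tree_hypertree T) (Emerald e)"
proof -
  obtain w g where wg: "(w, g) \<in> bip_edges G" and out: "Violet w \<notin> side T (v, e) (Violet v)"
    and "in": "Emerald g \<in> side T (v, e) (Violet v)"
    using assms(2) by (auto simp: entered_def)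
  obtain u where u: "(u, e) \<in> T" "u \<noteq> v" and T: "(v, e) \<in> T" using c by (auto simp: child_def)
  note pos_u = entering_pos[OF c u wg out "in"]
  have pos_v: "pos (Violet w, (w, g)) < pos (Violet v, a)" if "a \<in> incident (bip_edges G) (Violet v)" for a
  proof -
    have "(Violet v, a) \<in> darts" using that by (simp add: incident_def darts_def)
    then show ?thesis using pos_child[OF c, of "(Violet v, a)"] pos_u pos_parent[OF c u] by auto
  qed
  have "violet_less G rib b0 base T (Violet w) (Violet v)"
    unfolding violet_less_iff using pos_v wg
    by (intro bexI[of _ "(w, g)"]) (auto simp: incident_Violet)
  moreover have "Violet w \<in> violet G"
    using wg endpoints_nodes[of "(w, g)"] by (auto simp: bip_nodes_def emerald_def)
  ultimately show "internally_inactive G (violet G) (violet_less G rib b0 base T) (tree_hypertree T) (Violet v)"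
    using exchange_hypertree[OF T wg out "in"] unfolding internally_inactive_def by blast
  have "violet_less G rib b0 base T (Emerald g) (Emerald e)"
    unfolding violet_less_iff
  proof (intro bexI[of _ "(w, g)"] ballI)
    show "(w, g) \<in> incident (bip_edges G) (Emerald g)" using wg by (simp add: incident_Emerald)
    fix a assume "a \<in> incident (bip_edges G) (Emerald e)"
    then have "a = (u, e) \<or> a = (v, e)"
      using incident_emerald[of u e v] u T T_bip by auto
    then show "pos (Violet (fst (w, g)), (w, g)) < pos (Violet (fst a), a)"
      using pos_u pos_v[of "(v, e)"] T T_bip by (auto simp: incident_Violet)
  qed
  moreover have "Emerald g \<in> emerald G"
    using wg by (simp add: emerald_def bip_edges_iff)
  ultimately show "internally_inactive G (emerald G) (violet_less G rib b0 base T) (tree_hypertree T) (Emerald e)"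
    using exchange_hypertree[OF T wg out "in"] unfolding internally_inactive_def by blast
qed

text \<open>Charge each tree edge meeting the subtree to its end away from \<open>root\<close>. That
  end lies in the subtree, and no node is charged twice since it has only one edge towards
  \<open>root\<close>.\<close>

lemma card_side_edges:
  assumes c: "child v e"
  shows "card {a \<in> T. endpoints a \<inter> side T (v, e) (Violet v) \<noteq> {}} \<le> card (side T (v, e) (Violet v))"
    (is "card ?E \<le> card ?D")
proof -
  have T: "(v, e) \<in> T" and r: "root \<notin> ?D" using c by (auto simp: child_def)
  have "\<exists>x y. x \<in> ?D \<and> endpoints a = {y, x} \<and> root \<in> side T a y" if a: "a \<in> ?E" for a
  proof (cases "a = (v, e)")
    case True
    then have "root \<in> side T a (Emerald e)"
      using side_cover[OF T, of "Violet v" "Emerald e" root] r root_node by auto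
    then show ?thesis
      using True by (intro exI[of _ "Violet v"] exI[of _ "Emerald e"]) auto
  next
    case False
    then have sub: "endpoints a \<subseteq> ?D"
      using a side_edge_closed[of T "(v, e)" "Violet v"] by (auto simp: edge_closed_def)
    obtain p q where pq: "endpoints a = {p, q}" unfolding endpoints_def by blast
    have "root \<in> side T a p \<or> root \<in> side T a q"
      by (rule side_cover[OF _ pq root_node]) (use a in simp)
    then show ?thesis
    proof
      assume "root \<in> side T a p"
      then show ?thesis using sub pq by (intro exI[of _ q] exI[of _ p]) simp
    next
      assume "root \<in> side T a q"
      then show ?thesis using sub pq by (intro exI[of _ p] exI[of _ q]) (simp add: insert_commute)
    qed
  qed
  then have "\<forall>a\<in>?E. \<exists>x y. x \<in> ?D \<and> endpoints a = {y, x} \<and> root \<in> side T a y" by blast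
  from bchoice[OF this] obtain c
    where c: "\<forall>a\<in>?E. \<exists>y. c a \<in> ?D \<and> endpoints a = {y, c a} \<and> root \<in> side T a y" ..
  have "inj_on c ?E"
  proof (rule inj_onI)
    fix a b assume ab: "a \<in> ?E" "b \<in> ?E" "c a = c b"
    obtain y z where "endpoints a = {y, c a}" "root \<in> side T a y"
      "endpoints b = {z, c a}" "root \<in> side T b z"
      using bspec[OF c ab(1)] bspec[OF c ab(2)] ab(3) by auto
    then show "a = b" using parent_edge_unique ab(1,2) by blast
  qed
  moreover have "c ` ?E \<subseteq> ?D" using c by blast
  moreover have "finite ?D"
    using side_nodes[of "Violet v"] T_nodes[OF T] finite_nodes finite_subset by blast
  ultimately show ?thesis by (rule card_inj_on_le)
qed

text \<open>Suppose no edge enters \<open>D\<close>. Then every edge of \<open>S\<close> meeting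
  \<open>D\<close> has its violet end in \<open>D\<close>, so \<open>card D\<close> is at most the
  sum of the \<open>S\<close>-degrees of the violet nodes in \<open>D\<close>. As \<open>w\<close>
  is outside, this is one less than the sum of their \<open>T\<close>-degrees, itself at most
  \<open>card D\<close>.\<close>

lemma inactive_violet:
  assumes "v \<in> verts G"
    and "internally_inactive G (violet G) (violet_less G rib b0 base T) (tree_hypertree T) (Violet v)"
  shows "\<exists>e. child v e \<and> entered v e"
proof -
  let ?f = "tree_hypertree T"
  obtain w where w: "w \<in> verts G" "violet_less G rib b0 base T (Violet w) (Violet v)"
    "hypertree G (violet G) (?f(Violet v := ?f (Violet v) - 1, Violet w := ?f (Violet w) + 1))"
    using assms(2) by (auto simp: internally_inactive_def violet_def)
  have "Violet v \<noteq> root" using not_less_root w(2) by metis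
  then obtain e where c: "child v e" using child_of_violet assms(1) by blast
  let ?D = "side T (v, e) (Violet v)"
  let ?DV = "?D \<inter> violet G"
  have T: "(v, e) \<in> T" and r: "root \<notin> ?D" using c by (auto simp: child_def)
  have v: "Violet v \<in> ?DV" using assms(1) by (simp add: violet_def)
  have wD: "Violet w \<notin> ?D" using not_less_inside[OF c] w(2) by blast
  obtain S where S: "spanning_tree G S"
    "\<And>x. x \<in> violet G \<Longrightarrow> int (card (incident S x)) =
      (?f(Violet v := ?f (Violet v) - 1, Violet w := ?f (Violet w) + 1)) x + 1"
    using w(3) by (auto simp: hypertree_def)
  have DN: "?D \<subseteq> bip_nodes G" using side_nodes assms(1) by simp
  then have finD: "finite ?D" using finite_nodes finite_subset by blast
  have finS: "finite S" using S(1) by (rule finite_spanning_tree)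
  have "entered v e"
  proof (rule ccontr)
    assume ne: "\<not> entered v e"
    have "card ?D \<le> card {a \<in> S. endpoints a \<inter> ?D \<noteq> {}}"
      using S(1) DN root_node r finD finS
      by (intro card_le_incident_edges[of _ _ root]) (auto simp: spanning_tree_def)
    also have "\<dots> \<le> card (\<Union>x\<in>?DV. incident S x)"
    proof (rule card_mono)
      show "finite (\<Union>x\<in>?DV. incident S x)" using finD finS by (auto simp: incident_def)
      show "{a \<in> S. endpoints a \<inter> ?D \<noteq> {}} \<subseteq> (\<Union>x\<in>?DV. incident S x)"
      proof
        fix a assume a: "a \<in> {a \<in> S. endpoints a \<inter> ?D \<noteq> {}}"
        obtain p g where pg: "a = (p, g)" by (cases a)
        have "(p, g) \<in> bip_edges G" using a pg S(1) by (auto simp: spanning_tree_def)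
        then have "Violet p \<in> ?D" "Violet p \<in> violet G"
          using a pg ne endpoints_nodes[of "(p, g)"] by (auto simp: entered_def violet_def)
        then show "a \<in> (\<Union>x\<in>?DV. incident S x)" using a pg by (auto simp: incident_def)
      qed
    qed
    also have "\<dots> \<le> (\<Sum>x\<in>?DV. card (incident S x))"
      using finD by (intro card_UN_le) auto
    finally have 1: "int (card ?D) \<le> (\<Sum>x\<in>?DV. int (card (incident S x)))"
      unfolding of_nat_sum[symmetric] of_nat_le_iff .
    have "(\<Sum>x\<in>?DV. card (incident T x)) = card (\<Union>x\<in>?DV. incident T x)"
      using finD finite_T
      by (intro card_UN_disjoint[symmetric]) (auto simp: incident_def violet_def)
    also have "\<dots> \<le> card {a \<in> T. endpoints a \<inter> ?D \<noteq> {}}"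
      using finite_T by (intro card_mono) (auto simp: incident_def)
    also have "\<dots> \<le> card ?D" by (rule card_side_edges[OF c])
    finally have 2: "(\<Sum>x\<in>?DV. int (card (incident T x))) \<le> int (card ?D)"
      unfolding of_nat_sum[symmetric] of_nat_le_iff .
    have "(\<Sum>x\<in>?DV. int (card (incident S x))) = (\<Sum>x\<in>?DV. int (card (incident T x)) - (if x = Violet v then 1 else 0))"
    proof (rule sum.cong)
      fix x assume "x \<in> ?DV"
      then have "x \<in> violet G" "x \<noteq> Violet w" using wD by auto
      then show "int (card (incident S x)) = int (card (incident T x)) - (if x = Violet v then 1 else 0)"
        using S(2)[of x] by (simp add: tree_hypertree_def)
    qed simp
    also have "\<dots> = (\<Sum>x\<in>?DV. int (card (incident T x))) - 1"
      using finD v by (simp add: sum_subtractf)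
    finally show False using 1 2 by linarith
  qed
  then show ?thesis using c by blast
qed

text \<open>Connectivity replaces counting here: if \<open>g\<close> lies outside \<open>D\<close>,
  no emerald node can join violet nodes inside and outside \<open>D\<close> within \<open>S\<close>,
  so \<open>v\<close> cannot reach \<open>root\<close>.\<close>

lemma inactive_emerald:
  assumes e: "e \<in> edges G"
    and "internally_inactive G (emerald G) (violet_less G rib b0 base T) (tree_hypertree T) (Emerald e)"
  shows "\<exists>v. child v e \<and> entered v e"
proof -
  let ?f = "tree_hypertree T"
  obtain g where g: "g \<in> edges G" "violet_less G rib b0 base T (Emerald g) (Emerald e)"
    "hypertree G (emerald G) (?f(Emerald e := ?f (Emerald e) - 1, Emerald g := ?f (Emerald g) + 1))"
    using assms(2) by (auto simp: internally_inactive_def emerald_def)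
  have ge: "g \<noteq> e" using g(2) by (auto simp: violet_less_iff)
  obtain S where S: "spanning_tree G S"
    "\<And>x. x \<in> edges G \<Longrightarrow> int (card (incident S (Emerald x))) =
      (?f(Emerald e := ?f (Emerald e) - 1, Emerald g := ?f (Emerald g) + 1)) (Emerald x) + 1"
    using g(3) by (auto simp: hypertree_def emerald_def)
  have degT: "(p, h) \<in> T" if deg: "card (incident T (Emerald h)) \<ge> 2" and ph: "(p, h) \<in> bip_edges G" for p h
  proof -
    obtain q where q: "q \<noteq> p" "(q, h) \<in> bip_edges G" using emerald_ends[OF ph] by metis
    then have B: "incident (bip_edges G) (Emerald h) = {(p, h), (q, h)}"
      using incident_emerald[of p h q] ph by blast
    have "incident T (Emerald h) \<subseteq> incident (bip_edges G) (Emerald h)"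
      using T_subset by (auto simp: incident_def)
    moreover have "card (incident (bip_edges G) (Emerald h)) \<le> card (incident T (Emerald h))"
      using deg B q by simp
    ultimately have "incident T (Emerald h) = incident (bip_edges G) (Emerald h)"
      using finite_bip_edges by (intro card_seteq) (auto simp: incident_def)
    then show ?thesis using B by (auto simp: incident_def)
  qed
  obtain p q where pq: "p \<noteq> q" "(p, e) \<in> bip_edges G" "(q, e) \<in> bip_edges G"
  proof -
    have "ends G e \<noteq> {}" using e loopless by (auto simp: loopless_graph_def)
    then obtain p where "(p, e) \<in> bip_edges G" using e by (auto simp: bip_edges_iff)
    then show thesis using that emerald_ends by metis
  qed
  \<comment> \<open>The decreased value at \<open>e\<close> is still nonnegative, so
    \<open>e\<close> has two tree edges and hence a child.\<close>
  have "?f (Emerald e) \<ge> 1" using g(3) e ge by (auto simp: hypertree_def emerald_def)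
  then have "card (incident T (Emerald e)) \<ge> 2" by (simp add: tree_hypertree_def)
  then have "(p, e) \<in> T" "(q, e) \<in> T" using degT pq by blast+
  then obtain u v where c: "child v e" "(u, e) \<in> T" "u \<noteq> v"
    using child_of_emerald[of p e q] pq(1) by metis
  let ?D = "side T (v, e) (Violet v)"
  have T: "(v, e) \<in> T" and r: "root \<notin> ?D" using c by (auto simp: child_def)
  have D_iff: "Violet x \<in> ?D \<longleftrightarrow> Emerald h \<in> ?D" if "(x, h) \<in> T" "h \<noteq> e" for x h
    using side_edge_iff[of x h "(v, e)"] that by blast
  obtain w where w: "(w, g) \<in> bip_edges G" "pos (Violet w, (w, g)) < pos (Violet u, (u, e))"
  proof -
    obtain a where a: "a \<in> incident (bip_edges G) (Emerald g)"
      "\<forall>a'\<in>incident (bip_edges G) (Emerald e). pos (Violet (fst a), a) < pos (Violet (fst a'), a')"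
      using g(2) unfolding violet_less_iff by blast
    have "(u, e) \<in> incident (bip_edges G) (Emerald e)"
      using c(2) T_bip by (simp add: incident_Emerald)
    from bspec[OF a(2) this] show thesis
      using a(1) that[of "fst a"] by (cases a) (simp add: incident_Emerald)
  qed
  have w_early: "pos (Violet w, (w, g)) < pos (Emerald e, (v, e))" using w(2) pos_parent[OF c] by simp
  have wD: "Violet w \<notin> ?D"
    using pos_child[OF c(1) dart_Violet[OF w(1)]] w_early by simp
  have "entered v e"
  proof (cases "Emerald g \<in> ?D")
    case True
    then show ?thesis using w(1) wD by (auto simp: entered_def)
  next
    case gD: False
    \<comment> \<open>If \<open>x\<close> were in \<open>D\<close>, then \<open>(x, g)\<close> would
      not be in \<open>T\<close>, but \<open>(w, g)\<close> would. The cut condition puts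
      \<open>(Emerald g, (x, g))\<close> after \<open>(Emerald e, (v, e))\<close>, yet it directly
      follows \<open>(Violet w, (w, g))\<close>, which precedes
      \<open>(Emerald e, (v, e))\<close>.\<close>
    have no_end: "Violet x \<notin> ?D" if x: "(x, g) \<in> bip_edges G" for x
    proof
      assume xD: "Violet x \<in> ?D"
      have xT: "(x, g) \<notin> T" using D_iff[of x g] xD gD ge by blast
      have xw: "x \<noteq> w" using xD wD by blast
      have "card (incident T (Emerald g)) \<ge> 1" using degree_pos[OF tree] g(1) by simp
      then have "incident T (Emerald g) \<noteq> {}" by auto
      then obtain a where a: "a \<in> T" "a \<in> incident (bip_edges G) (Emerald g)"
        using T_bip by (auto simp: incident_def)
      then have wT: "(w, g) \<in> T"
        using incident_emerald[OF x w(1) xw] xT by auto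
      have "pos (Emerald e, (v, e)) < pos (Violet x, (x, g))"
        using pos_child[OF c(1) dart_Violet[OF x]] xD by simp
      also have "\<dots> < pos (Emerald g, (x, g))" using cut_pos x xT by blast
      finally have late: "pos (Emerald e, (v, e)) < pos (Emerald g, (x, g))" .
      have "step (Violet w, (w, g)) = (Emerald g, (x, g))"
        using step_tree[OF wT, of "Violet w" "Emerald g"] rib_emerald[of w g x] w(1) x xw by simp
      moreover have "(Emerald g, (x, g)) \<noteq> (b0, base)" using late pos_base by auto
      ultimately have "pos (Emerald g, (x, g)) = Suc (pos (Violet w, (w, g)))"
        using pos_step[OF dart_Violet[OF w(1)]] by simp
      then show False using late w_early by simp
    qed
    \<comment> \<open>Emerald membership is read off from \<open>S\<close> and not from
      \<open>D\<close>, since \<open>S\<close> may attach an emerald node to the other side. What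
      remains is that no emerald node has \<open>S\<close>-neighbours on both sides.\<close>
    let ?X = "{Violet x | x. Violet x \<in> ?D} \<union> {Emerald h | h. \<exists>x. (x, h) \<in> S \<and> Violet x \<in> ?D}"
    have closed: "edge_closed S ?X"
    proof (rule edge_closedI)
      fix x h assume xh: "(x, h) \<in> S"
      have "Violet x \<in> ?D" if y: "(y, h) \<in> S" "Violet y \<in> ?D" for y
      proof (rule ccontr)
        assume xD: "Violet x \<notin> ?D"
        have B: "(x, h) \<in> bip_edges G" "(y, h) \<in> bip_edges G"
          using S(1) xh y by (auto simp: spanning_tree_def)
        have hE: "h \<in> edges G" using B by (simp add: bip_edges_iff)
        have "finite S" using S(1) by (rule finite_spanning_tree)
        then have "card {(x, h), (y, h)} \<le> card (incident S (Emerald h))"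
          using xh y(1) by (intro card_mono) (auto simp: incident_def)
        moreover have "x \<noteq> y" using xD y by blast
        ultimately have deg: "card (incident S (Emerald h)) \<ge> 2" by simp
        have hg: "h \<noteq> g" using no_end B y by blast
        \<comment> \<open>\<open>e\<close> has lost one of at most two edges, so it joins nothing in
          \<open>S\<close>. Any other \<open>h\<close> here differs from \<open>g\<close> and keeps
          its degree, so both its edges are in \<open>T\<close> and lie on one side.\<close>
        show False
        proof (cases "h = e")
          case True
          have "incident T (Emerald e) \<subseteq> {(x, e), (y, e)}"
            using incident_emerald[of x h y] B \<open>x \<noteq> y\<close> T_subset True by (auto simp: incident_def)
          then have "card (incident T (Emerald e)) \<le> card {(x, e), (y, e)}" by (intro card_mono) auto
          also have "\<dots> = 2" using \<open>x \<noteq> y\<close> by simp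
          finally show False using S(2)[OF hE] deg True ge by (simp add: tree_hypertree_def)
        next
          case False
          then have "card (incident T (Emerald h)) \<ge> 2"
            using S(2)[OF hE] deg hg by (simp add: tree_hypertree_def)
          then show False using degT B D_iff False xD y(2) by metis
        qed
      qed
      then show "Violet x \<in> ?X \<longleftrightarrow> Emerald h \<in> ?X" using xh by auto
    qed
    have "(adjacent S)\<^sup>*\<^sup>* (Violet v) root"
      using S(1) root_node T_nodes[OF T] by (simp add: spanning_tree_def)
    from reach_edge_closed[OF this closed] have "root \<in> ?X" by simp
    then show ?thesis using r by (auto simp: root_def)
  qed
  then show ?thesis using c by blast
qed

text \<open>Both sets are projections of the relation between children and parents whose subtree is
  entered; uniqueness of parent and of child makes both projections injective.\<close>

lemma card_inactive_eq:
  "card {x \<in> emerald G. internally_inactive G (emerald G)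
      (violet_less G rib b0 base T) (tree_hypertree T) x}
   = card {x \<in> violet G. internally_inactive G (violet G)
      (violet_less G rib b0 base T) (tree_hypertree T) x}"
proof -
  let ?R = "{(v, e). child v e \<and> entered v e}"
  have nodes: "v \<in> verts G" "e \<in> edges G" if "child v e" for v e
    using that T_nodes by (auto simp: child_def)
  have E: "{x \<in> emerald G. internally_inactive G (emerald G)
      (violet_less G rib b0 base T) (tree_hypertree T) x} = (\<lambda>a. Emerald (snd a)) ` ?R"
    using inactive_emerald entered_inactive(2) nodes by (force simp: emerald_def image_iff)
  have V: "{x \<in> violet G. internally_inactive G (violet G)
      (violet_less G rib b0 base T) (tree_hypertree T) x} = (\<lambda>a. Violet (fst a)) ` ?R"
    using inactive_violet entered_inactive(1) nodes by (force simp: violet_def image_iff)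
  have "inj_on (\<lambda>a. Emerald (snd a)) ?R" "inj_on (\<lambda>a. Violet (fst a)) ?R"
    using child_unique_violet child_unique_emerald by (auto simp: inj_on_def)
  from this[THEN card_image] show ?thesis unfolding E V by (rule trans[OF _ sym])
qed

end

theorem theorem8p1:
  fixes G :: "('v, 'e) mgraph"
    and rib :: "('v, 'e) node \<Rightarrow> ('v, 'e) bedge \<Rightarrow> ('v, 'e) bedge"
    and b0 :: "('v, 'e) node" and base :: "('v, 'e) bedge"
    and T :: "('v, 'e) bedge set"
  assumes "loopless_graph G"
    and "ribbon_structure G rib"
    and "b0 \<in> bip_nodes G"
    and "base \<in> incident (bip_edges G) b0"
    and "V_cut_Jaeger_tree G rib b0 base T"
  shows "card {x \<in> emerald G. internally_inactive G (emerald G)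
                 (violet_less G rib b0 base T) (tree_hypertree T) x}
       = card {x \<in> violet G. internally_inactive G (violet G)
                 (violet_less G rib b0 base T) (tree_hypertree T) x}"
  by (rule jaeger_tree.card_inactive_eq, rule jaeger_tree.intro) (use assms in blast)+

end
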